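(* Let $k$ be an algebraically closed field of characteristic $2$ and $\nu\ge 1$. The polynomial $\Delta$, viewed as a polynomial over $k$ (an element of $R_{2\nu\times 2\nu}$), is invariant under $SO(2\nu)$ but not under $O(2\nu)$.
   Context: $k$ is an algebraically closed field of characteristic $2$. $O(2\nu)$ is the group of linear automorphisms of $k^{2\nu}$ (coordinates $x_1,\dots,x_\nu,y_1,\dots,y_\nu$) preserving the quadratic form $q=x_1y_1+\dots+x_\nu y_\nu$; $SO(2\nu)$ is the connected component of the identity in the algebraic group $O(2\nu)$ (equivalently, the subgroup, of index $2$, of elements that are products of an even number of reflections $T_u v=v-\frac{\beta(v,u)}{q(u)}u$, $q(u)\ne0$, where $\beta(v,w)=q(v+w)-q(v)-q(w)$). $R_{2\nu\times 2\nu}$ is the algebra of polynomials over $k$ in the coordinates $x_t^{(i)},y_t^{(i)}$ of $2\nu$ indeterminate vectors $v^{(1)},\dots,v^{(2\nu)}$ in $k^{2\nu}$, with $O(2\nu)$ acting diagonally. Definition of $\Delta$: working over $\mathbb{Z}$ in the variables $x_t^{(i)},y_t^{(i)}$ ($1\le t\le\nu$, $1\le i\le 2\nu$), put $B^{(ij)}=\sum_{t=1}^{\nu}\left(x_t^{(i)}y_t^{(j)}+y_t^{(i)}x_t^{(j)}\right)$ and let $D=\det[v^{(1)},\dots,v^{(2\nu)}]$ be the determinant of the matrix with columns $v^{(i)}=(x_1^{(i)},\dots,x_\nu^{(i)},y_1^{(i)},\dots,y_\nu^{(i)})^T$. Consider $$\sum B^{(i_1i_2)}B^{(i_3i_4)}\cdots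 B^{(i_{2\nu-1}i_{2\nu})},$$ the sum being over those permutations $i_1,\dots,i_{2\nu}$ of $1,\dots,2\nu$ with $i_1<i_2$, $i_3<i_4$, ..., $i_{2\nu-1}<i_{2\nu}$ and $i_1<i_3<\dots<i_{2\nu-1}$. The difference of this sum and $D$ has all coefficients even, and $\Delta$ is the polynomial with integer coefficients defined by $$2\Delta=\sum B^{(i_1i_2)}B^{(i_3i_4)}\cdots B^{(i_{2\nu-1}i_{2\nu})}-D.$$ It is viewed over $k$ by reducing coefficients modulo $2$. *)

theory Defs
  imports
    "HOL-Library.Poly_Mapping"
    "HOL-Analysis.Abstract_Topology_2"
    "Jordan_Normal_Form.Determinant"
begin

section \<open>Multivariate polynomials\<close>

text \<open>A polynomial is a finitely supported family of coefficients indexed by monomials, and a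
  monomial is a finitely supported exponent vector. The ring structure on this type is the
  convolution product of \<^theory>\<open>HOL-Library.Poly_Mapping\<close>.\<close>

type_synonym ('v, 'a) mpoly = "('v \<Rightarrow>\<^sub>0 nat) \<Rightarrow>\<^sub>0 'a"

definition Const :: "'a::zero \<Rightarrow> ('v, 'a) mpoly" where
  "Const c = Poly_Mapping.single 0 c"

definition Var :: "'v \<Rightarrow> ('v, 'a::{zero,one}) mpoly" where
  "Var x = Poly_Mapping.single (Poly_Mapping.single x 1) 1"

definition polys_in :: "'v set \<Rightarrow> ('v, 'a::zero) mpoly set" where
  "polys_in X = {p. \<forall>m \<in> Poly_Mapping.keys p. Poly_Mapping.keys m \<subseteq> X}"

text \<open>Coefficients are sent through \<open>h\<close> and the variable \<open>x\<close> is replaced by \<open>s x\<close>; with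
  \<open>h = Const\<close> this is substitution of polynomials for the variables.\<close>

definition eval_with :: "('a::zero \<Rightarrow> 'b) \<Rightarrow> ('v \<Rightarrow> 'b) \<Rightarrow> ('v, 'a) mpoly \<Rightarrow> 'b::comm_semiring_1" where
  "eval_with h s p = (\<Sum>m \<in> Poly_Mapping.keys p. h (Poly_Mapping.lookup p m) *
     (\<Prod>x \<in> Poly_Mapping.keys m. s x ^ Poly_Mapping.lookup m x))"

section \<open>The groups $O(2\nu)$ and $SO(2\nu)$\<close>

text \<open>Coordinates of a vector of dimension \<open>2 * \<nu>\<close> are numbered from 0: position \<open>t < \<nu>\<close> holds
  $x_{t+1}$ and position \<open>\<nu> + t\<close> holds $y_{t+1}$.\<close>

definition quad :: "nat \<Rightarrow> 'k::comm_ring_1 vec \<Rightarrow> 'k" where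
  "quad \<nu> v = (\<Sum>t<\<nu>. (v $ t) * (v $ (\<nu> + t)))"

definition O_group :: "nat \<Rightarrow> 'k::field mat set" where
  "O_group \<nu> = {g \<in> carrier_mat (2 * \<nu>) (2 * \<nu>). invertible_mat g \<and>
     (\<forall>v \<in> carrier_vec (2 * \<nu>). quad \<nu> (g *\<^sub>v v) = quad \<nu> v)}"

text \<open>The Zariski topology on \<open>n \<times> n\<close> matrices, generated by the principal open sets (the
  non-vanishing loci of single polynomials in the matrix entries).\<close>

definition zariski_mat :: "nat \<Rightarrow> 'k::field mat topology" where
  "zariski_mat n = topology_generated_by
     ((\<lambda>p. {A \<in> carrier_mat n n. eval_with id (\<lambda>ij. A $$ ij) p \<noteq> 0}) `
        polys_in ({0..<n} \<times> {0..<n}))"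

definition SO_group :: "nat \<Rightarrow> 'k::field mat set" where
  "SO_group \<nu> =
     connected_component_of_set (subtopology (zariski_mat (2 * \<nu>)) (O_group \<nu>)) (1\<^sub>m (2 * \<nu>))"

section \<open>Polynomials in the coordinates of $2\nu$ vectors\<close>

text \<open>The variable \<open>(s, i)\<close> is coordinate \<open>s\<close> of the \<open>i\<close>-th indeterminate vector, i.e. the entry in
  row \<open>s\<close> and column \<open>i\<close> of the matrix with the vectors as columns; the vectors too are numbered
  from 0.\<close>

definition R_alg :: "nat \<Rightarrow> (nat \<times> nat, 'k::field) mpoly set" where
  "R_alg \<nu> = polys_in ({0..<2 * \<nu>} \<times> {0..<2 * \<nu>})"

text \<open>\<open>diag_act \<nu> g f\<close> is $f(g v^{(1)}, \dots, g v^{(2\nu)})$. The usual left action uses the inverse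
  of \<open>g\<close> instead, which gives the same invariants for any group of matrices.\<close>

definition diag_act ::
  "nat \<Rightarrow> 'k::field mat \<Rightarrow> (nat \<times> nat, 'k) mpoly \<Rightarrow> (nat \<times> nat, 'k) mpoly" where
  "diag_act \<nu> g f =
     eval_with Const (\<lambda>(s, i). \<Sum>t<2 * \<nu>. Const (g $$ (s, t)) * Var (t, i)) f"

definition invariant_under ::
  "nat \<Rightarrow> 'k::field mat set \<Rightarrow> (nat \<times> nat, 'k) mpoly \<Rightarrow> bool" where
  "invariant_under \<nu> G f \<longleftrightarrow> (\<forall>g \<in> G. diag_act \<nu> g f = f)"

section \<open>The polynomial $\Delta$\<close>

definition B_poly :: "nat \<Rightarrow> nat \<Rightarrow> nat \<Rightarrow> (nat \<times> nat, int) mpoly" where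
  "B_poly \<nu> i j =
     (\<Sum>t<\<nu>. Var (t, i) * Var (\<nu> + t, j) + Var (\<nu> + t, i) * Var (t, j))"

definition D_poly :: "nat \<Rightarrow> (nat \<times> nat, int) mpoly" where
  "D_poly \<nu> = det (mat (2 * \<nu>) (2 * \<nu>) Var)"

text \<open>With indices from 0, $i_{2r+1}$ and $i_{2r+2}$ of the usual notation are \<open>p (2 * r)\<close> and
  \<open>p (2 * r + 1)\<close>.\<close>

definition pairing_perms :: "nat \<Rightarrow> (nat \<Rightarrow> nat) set" where
  "pairing_perms \<nu> = {p. p permutes {0..<2 * \<nu>} \<and>
     (\<forall>r<\<nu>. p (2 * r) < p (2 * r + 1)) \<and>
     (\<forall>r. r + 1 < \<nu> \<longrightarrow> p (2 * r) < p (2 * (r + 1)))}"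

definition S_poly :: "nat \<Rightarrow> (nat \<times> nat, int) mpoly" where
  "S_poly \<nu> = (\<Sum>p \<in> pairing_perms \<nu>. \<Prod>r<\<nu>. B_poly \<nu> (p (2 * r)) (p (2 * r + 1)))"

definition Delta_int :: "nat \<Rightarrow> (nat \<times> nat, int) mpoly" where
  "Delta_int \<nu> = (THE d. 2 * d = S_poly \<nu> - D_poly \<nu>)"

definition Delta :: "nat \<Rightarrow> (nat \<times> nat, 'k::field) mpoly" where
  "Delta \<nu> = Poly_Mapping.map of_int (Delta_int \<nu>)"

end

theory Submission
  imports Defs "HOL-Library.Product_Lexorder"
begin

text \<open>Write \<open>S\<close> for the pairing sum, \<open>D\<close> for the determinant and \<open>G\<close> for the Gram matrix of
  the vectors \<open>v\<^sub>1, \<dots>, v\<^sub>n\<close> (with \<open>n = 2\<nu>\<close>), whose entries are \<open>B\<^sub>i\<^sub>j\<close> off the diagonal and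
  \<open>B\<^sub>i\<^sub>i = 2 q(v\<^sub>i)\<close> on it. The reason for the theorem is that \<open>\<Delta>\<close> is a root of a quadratic
  equation whose coefficients are invariant under the whole orthogonal group.

  Over the integers \<open>D\<^sup>2 = (-1)\<^sup>\<nu> det G\<close> and \<open>S = 2\<Delta> + D\<close>, hence
  \<open>(-1)\<^sup>\<nu> det G - S\<^sup>2 = - 4 \<Delta> (\<Delta> + D)\<close>. The left-hand side is a polynomial in the \<open>q(v\<^sub>i)\<close>
  and \<open>B\<^sub>i\<^sub>j\<close>, since \<open>S\<close> is the hafnian of \<open>G\<close>. The point is that the division by 4 can be
  done before the coordinates are substituted: for \<^emph>\<open>every\<close> symmetric matrix with even
  diagonal, \<open>(-1)\<^sup>\<nu> det G - haf(G)\<^sup>2\<close> is divisible by 4 (lemma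
  \<open>hafnian_cong_4_even_symmetric\<close>), and this may be applied to a matrix of indeterminates.
  So \<open>\<Delta>(\<Delta> + D)\<close> is an integral polynomial in the \<open>q(v\<^sub>i)\<close> and \<open>B\<^sub>i\<^sub>j\<close> (lemma
  \<open>norm_Delta_in_gram\<close>).

  Over \<open>k\<close> one has \<open>D = S\<close>, so \<open>D\<close> too is a polynomial in the \<open>B\<^sub>i\<^sub>j\<close>. For \<open>g\<close> in the
  orthogonal group, \<open>g\<Delta>\<close> and \<open>\<Delta>\<close> are therefore roots of the same equation
  \<open>X (X + D) = \<Delta> (\<Delta> + D)\<close> in an integral domain, which leaves only \<open>g\<Delta> = \<Delta>\<close> and \<open>g\<Delta> = \<Delta> + D\<close>
  (lemma \<open>diag_act_dichotomy\<close>). The two cases are told apart by the value of \<open>\<Delta>\<close> at the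
  matrix \<open>g\<close> itself, which is 0 in the first case and 1 in the second. Thus the group is the
  disjoint union of the open subsets \<open>\<Delta>(g) \<noteq> 1\<close> and \<open>\<Delta>(g) \<noteq> 0\<close>, and the identity component
  lies in the first one. The exchange of \<open>x\<^sub>1\<close> and \<open>y\<^sub>1\<close> lies in the second one, because
  over the integers it has \<open>S = 1\<close> and \<open>D = -1\<close>.

  The congruence modulo 4 is proved by elimination. A change of basis \<open>U\<close> multiplies \<open>det G\<close>
  by \<open>(det U)\<^sup>2\<close> and, modulo 2, multiplies \<open>haf(G)\<close> by \<open>det U\<close> (lemma
  \<open>hafnian_base_change_mod_2\<close>), so the congruence may be checked after any change of basis
  of odd determinant. If some entry of \<open>G\<close> is odd, such a change of basis splits off a
  plane, and induction applies. Expansion of the hafnian under a change of basis also yields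
  \<open>S \<equiv> D\<close> modulo 2, so that \<open>\<Delta>\<close> exists in the first place.\<close>

section \<open>Evaluation and reduction of polynomials\<close>

text \<open>The value of a monomial. The lemmas up to \<open>map_eq_eval_with\<close> establish that evaluation
  and substitution are ring homomorphisms; all later transfers between polynomial rings rest
  on this.\<close>

definition mono_val :: "('v \<Rightarrow> 'b::comm_semiring_1) \<Rightarrow> ('v \<Rightarrow>\<^sub>0 nat) \<Rightarrow> 'b" where
  "mono_val s m = (\<Prod>x \<in> Poly_Mapping.keys m. s x ^ Poly_Mapping.lookup m x)"

lemma mono_val_superset:
  assumes "finite X" "Poly_Mapping.keys m \<subseteq> X"
  shows "mono_val s m = (\<Prod>x\<in>X. s x ^ Poly_Mapping.lookup m x)"
  unfolding mono_val_def
  by (rule prod.mono_neutral_left) (use assms in \<open>auto simp: in_keys_iff\<close>)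

lemma mono_val_0 [simp]: "mono_val s 0 = 1"
  by (simp add: mono_val_def)

lemma mono_val_add: "mono_val s (m + n) = mono_val s m * mono_val s n"
proof -
  let ?X = "Poly_Mapping.keys m \<union> Poly_Mapping.keys n"
  have "Poly_Mapping.keys (m + n) \<subseteq> ?X" by (rule Poly_Mapping.keys_add)
  then show ?thesis
    by (simp add: mono_val_superset[of ?X] lookup_add power_add prod.distrib)
qed

lemma mono_val_single [simp]: "mono_val s (Poly_Mapping.single x n) = s x ^ n"
  by (cases "n = 0") (simp_all add: mono_val_def)

lemma eval_with_superset:
  assumes "finite X" "Poly_Mapping.keys p \<subseteq> X" "h 0 = 0"
  shows "eval_with h s p = (\<Sum>m\<in>X. h (Poly_Mapping.lookup p m) * mono_val s m)"
  unfolding eval_with_def mono_val_def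
  by (rule sum.mono_neutral_left) (use assms in \<open>auto simp: in_keys_iff\<close>)

lemma eval_with_single:
  assumes "h 0 = 0"
  shows "eval_with h s (Poly_Mapping.single m c) = h c * mono_val s m"
  by (subst eval_with_superset[where X = "{m}"]) (use assms in \<open>auto\<close>)

lemma eval_with_0 [simp]: "eval_with h s 0 = 0"
  by (simp add: eval_with_def)

context comm_ring_hom
begin

lemma eval_with_add: "eval_with hom s (p + q) = eval_with hom s p + eval_with hom s q"
proof -
  let ?X = "Poly_Mapping.keys p \<union> Poly_Mapping.keys q"
  have "Poly_Mapping.keys (p + q) \<subseteq> ?X" by (rule Poly_Mapping.keys_add)
  then show ?thesis
    by (simp add: eval_with_superset[of ?X] lookup_add hom_add distrib_right sum.distrib)
qed

lemma eval_with_sum: "eval_with hom s (\<Sum>i\<in>A. f i) = (\<Sum>i\<in>A. eval_with hom s (f i))"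
  by (induction A rule: infinite_finite_induct) (auto simp: eval_with_add)

lemma eval_with_mult: "eval_with hom s (p * q) = eval_with hom s p * eval_with hom s q"
proof -
  have rep: "r = (\<Sum>m\<in>Poly_Mapping.keys r. Poly_Mapping.single m (Poly_Mapping.lookup r m))"
    for r :: "('v, 'a) mpoly"
    by (rule poly_mapping_eqI) (simp add: lookup_sum lookup_single when_def in_keys_iff)
  have "p * q = (\<Sum>m\<in>Poly_Mapping.keys p. \<Sum>n\<in>Poly_Mapping.keys q.
      Poly_Mapping.single (m + n) (Poly_Mapping.lookup p m * Poly_Mapping.lookup q n))"
    by (subst rep[of p], subst rep[of q]) (simp add: sum_product mult_single)
  also have "eval_with hom s \<dots> = eval_with hom s p * eval_with hom s q"
    by (simp add: eval_with_sum eval_with_single mono_val_add hom_mult sum_product mult_ac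
        eval_with_superset[of "Poly_Mapping.keys p" p] eval_with_superset[of "Poly_Mapping.keys q"
            q])
  finally show ?thesis .
qed

lemma comm_ring_hom_eval_with: "comm_ring_hom (eval_with hom s)"
proof
  show "eval_with hom s 1 = 1"
    using eval_with_single[of hom s 0 1] by simp
qed (simp_all add: eval_with_add eval_with_mult)

end

lemma comm_ring_hom_Const: "comm_ring_hom (Const :: 'a::comm_ring_1 \<Rightarrow> ('v, 'a) mpoly)"
  by standard (simp_all add: Const_def single_add mult_single)

lemma comm_ring_hom_id: "comm_ring_hom (id :: 'a::comm_ring_1 \<Rightarrow> 'a)"
  by standard simp_all

lemma comm_ring_hom_comp:
  assumes "comm_ring_hom f" "comm_ring_hom g"
  shows "comm_ring_hom (f \<circ> g)"
proof -
  interpret f: comm_ring_hom f by fact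
  interpret g: comm_ring_hom g by fact
  show ?thesis by standard (simp_all add: f.hom_add g.hom_add f.hom_mult g.hom_mult)
qed

lemma eval_with_Var:
  assumes "comm_ring_hom h" shows "eval_with h s (Var x) = s x"
proof -
  interpret comm_ring_hom h by fact
  show ?thesis unfolding Var_def by (simp add: eval_with_single)
qed

lemma eval_with_Const:
  assumes "comm_ring_hom h" shows "eval_with h s (Const c) = h c"
proof -
  interpret comm_ring_hom h by fact
  show ?thesis unfolding Const_def by (simp add: eval_with_single)
qed

lemma hom_eval_with:
  assumes "comm_ring_hom f"
  shows "f (eval_with h s p) = eval_with (f \<circ> h) (f \<circ> s) p"
proof -
  interpret comm_ring_hom f by fact
  show ?thesis unfolding eval_with_def by (simp add: hom_sum hom_mult hom_prod hom_power)
qed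

lemma mono_val_Var: "mono_val Var m = (Poly_Mapping.single m 1 :: ('v, 'a::comm_ring_1) mpoly)"
proof -
  have pow: "Var x ^ n = (Poly_Mapping.single (Poly_Mapping.single x n) 1 :: ('v, 'a) mpoly)" for
      x :: 'v and n
    by (induction n) (simp_all add: Var_def mult_single single_add[symmetric])
  have prod_single: "(\<Prod>x\<in>X. Poly_Mapping.single (f x) (1::'a)) = Poly_Mapping.single (sum f X) 1"
    for f :: "'v \<Rightarrow> 'v \<Rightarrow>\<^sub>0 nat" and X
    by (induction X rule: infinite_finite_induct) (simp_all add: mult_single)
  have "(\<Sum>x\<in>Poly_Mapping.keys m. Poly_Mapping.single x (Poly_Mapping.lookup m x)) = m"
    by (rule poly_mapping_eqI) (simp add: lookup_sum lookup_single when_def in_keys_iff)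
  then show ?thesis
    by (simp add: mono_val_def pow prod_single)
qed

lemma map_eq_eval_with:
  assumes "comm_ring_hom h"
  shows "Poly_Mapping.map h = (eval_with (Const \<circ> h) Var :: ('v, 'a::comm_ring_1) mpoly \<Rightarrow> ('v,
      'b::comm_ring_1) mpoly)"
proof
  fix p :: "('v, 'a) mpoly"
  interpret comm_ring_hom h by fact
  show "Poly_Mapping.map h p = eval_with (Const \<circ> h) Var p"
    unfolding eval_with_def mono_val_def[symmetric] mono_val_Var
    by (rule poly_mapping_eqI)
      (simp add: Const_def mult_single lookup_sum lookup_single map.rep_eq when_def in_keys_iff)
qed

lemma lookup_two_times:
  fixes q :: "('v, int) mpoly"
  shows "Poly_Mapping.lookup (2 * q) m = 2 * Poly_Mapping.lookup q m"
  by (simp only: mult_2 lookup_add)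

text \<open>Coefficientwise, an integer vanishes in a field of characteristic 2 exactly if it is
  even.\<close>

lemma map_of_int_eq_0_iff:
  fixes p :: "('v, int) mpoly"
  assumes "CHAR('k::field) = 2"
  shows "Poly_Mapping.map (of_int :: int \<Rightarrow> 'k) p = 0 \<longleftrightarrow> 2 dvd p"
proof -
  have ev: "(of_int c :: 'k) = 0 \<longleftrightarrow> even c" for c
    using of_int_eq_0_iff_char_dvd[where 'a = 'k, of c] assms by simp
  have lookup_map: "Poly_Mapping.lookup (Poly_Mapping.map h p) m = h (Poly_Mapping.lookup p m)"
    if "h 0 = 0" for h :: "int \<Rightarrow> 'c::zero" and m
    using that by (simp add: map.rep_eq when_def)
  show ?thesis
  proof
    assume z: "Poly_Mapping.map (of_int :: int \<Rightarrow> 'k) p = 0"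
    have e: "even (Poly_Mapping.lookup p m)" for m
      using arg_cong[OF z, of "\<lambda>q. Poly_Mapping.lookup q m"] by (simp add: lookup_map ev)
    have "p = 2 * Poly_Mapping.map (\<lambda>c. c div 2) p"
    proof (rule poly_mapping_eqI)
      fix m
      show "Poly_Mapping.lookup p m = Poly_Mapping.lookup (2 * Poly_Mapping.map (\<lambda>c. c div 2) p) m"
        using e[of m] by (simp add: lookup_two_times lookup_map)
    qed
    then show "2 dvd p" by (rule dvdI)
  next
    assume "2 dvd p"
    then obtain q where "p = 2 * q" ..
    then have "even (Poly_Mapping.lookup p m)" for m by (simp add: lookup_two_times)
    then show "Poly_Mapping.map (of_int :: int \<Rightarrow> 'k) p = 0"
      by (intro poly_mapping_eqI) (simp add: lookup_map ev)
  qed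
qed

text \<open>The quotient modulo 2 embeds into a polynomial ring over a field, which is an integral
  domain. The lexicographic order on the variables makes that ring an instance of the class
  of integral domains.\<close>

lemma prime_elem_2_int_mpoly:
  assumes char2: "CHAR('k::field) = 2"
  shows "prime_elem (2 :: (nat \<times> nat, int) mpoly)"
proof -
  have hom: "comm_ring_hom (Poly_Mapping.map (of_int :: int \<Rightarrow> 'k) ::
      (nat \<times> nat, int) mpoly \<Rightarrow> (nat \<times> nat, 'k) mpoly)"
    unfolding map_eq_eval_with[OF of_int_hom.comm_ring_hom_axioms]
    by (intro comm_ring_hom.comm_ring_hom_eval_with comm_ring_hom_comp comm_ring_hom_Const
        of_int_hom.comm_ring_hom_axioms)
  interpret comm_ring_hom "Poly_Mapping.map (of_int :: int \<Rightarrow> 'k) :: (nat \<times> nat, int) mpoly \<Rightarrow> _"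
    by (rule hom)
  show ?thesis
  proof (rule prime_elemI)
    show "(2 :: (nat \<times> nat, int) mpoly) \<noteq> 0" by simp
    show "\<not> 2 dvd (1 :: (nat \<times> nat, int) mpoly)"
      by (simp flip: map_of_int_eq_0_iff[OF char2])
    show "2 dvd p \<or> 2 dvd q" if "2 dvd p * q" for p q :: "(nat \<times> nat, int) mpoly"
      using that by (simp flip: map_of_int_eq_0_iff[OF char2] add: hom_mult)
  qed
qed

lemma polys_in_Var: "x \<in> X \<Longrightarrow> (Var x :: ('v, 'a::zero_neq_one) mpoly) \<in> polys_in X"
  by (simp add: polys_in_def Var_def)

lemma polys_in_0: "0 \<in> polys_in X"
  by (simp add: polys_in_def)

lemma polys_in_1: "(1 :: ('v, 'a::comm_ring_1) mpoly) \<in> polys_in X"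
  by (simp add: polys_in_def)

lemma polys_in_add: "p \<in> polys_in X \<Longrightarrow> q \<in> polys_in X \<Longrightarrow> p + q \<in> polys_in X"
  unfolding polys_in_def using Poly_Mapping.keys_add[of p q] by blast

lemma polys_in_diff:
  fixes p q :: "('v, 'a::comm_ring_1) mpoly"
  shows "p \<in> polys_in X \<Longrightarrow> q \<in> polys_in X \<Longrightarrow> p - q \<in> polys_in X"
  unfolding polys_in_def using Poly_Mapping.keys_diff[of p q] by blast

lemma polys_in_mult:
  fixes p q :: "('v, 'a::comm_ring_1) mpoly"
  assumes "p \<in> polys_in X" "q \<in> polys_in X" shows "p * q \<in> polys_in X"
proof -
  have "Poly_Mapping.keys m \<subseteq> X" if m: "m \<in> Poly_Mapping.keys (p * q)" for m
  proof -
    obtain a b where "m = a + b" "a \<in> Poly_Mapping.keys p" "b \<in> Poly_Mapping.keys q"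
      using subsetD[OF keys_mult[of p q] m] by blast
    then show ?thesis
      using assms Poly_Mapping.keys_add[of a b] unfolding polys_in_def by blast
  qed
  then show ?thesis by (simp add: polys_in_def)
qed

lemma polys_in_sum:
  "(\<And>i. i \<in> A \<Longrightarrow> f i \<in> polys_in X) \<Longrightarrow> (\<Sum>i\<in>A. f i) \<in> polys_in X"
  by (induction A rule: infinite_finite_induct) (auto intro: polys_in_add polys_in_0)

lemma polys_in_prod:
  fixes f :: "'i \<Rightarrow> ('v, 'a::comm_ring_1) mpoly"
  shows "(\<And>i. i \<in> A \<Longrightarrow> f i \<in> polys_in X) \<Longrightarrow> (\<Prod>i\<in>A. f i) \<in> polys_in X"
  by (induction A rule: infinite_finite_induct) (auto intro: polys_in_mult polys_in_1)

lemma eval_with_cong: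
  assumes "p \<in> polys_in X" "\<And>x. x \<in> X \<Longrightarrow> s x = t x"
  shows "eval_with h s p = eval_with h t p"
proof -
  have "(\<Prod>x \<in> Poly_Mapping.keys m. s x ^ Poly_Mapping.lookup m x) =
      (\<Prod>x \<in> Poly_Mapping.keys m. t x ^ Poly_Mapping.lookup m x)" if "m \<in> Poly_Mapping.keys p" for m
    by (rule prod.cong) (use assms that in \<open>auto simp: polys_in_def subset_iff\<close>)
  then show ?thesis unfolding eval_with_def by simp
qed

section \<open>Hafnians as sums over perfect matchings\<close>

definition perfect_matchings :: "'i set \<Rightarrow> 'i set set set" where
  "perfect_matchings A = {M. \<Union>M = A \<and> disjoint M \<and> (\<forall>e\<in>M. card e = 2)}"

text \<open>An edge is an unordered pair, so its two ends are recovered as minimum and maximum.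
  For symmetric \<open>G\<close> any other choice gives the same weight.\<close>

definition hafnian :: "(nat \<Rightarrow> nat \<Rightarrow> 'a::comm_ring_1) \<Rightarrow> nat set \<Rightarrow> 'a" where
  "hafnian G A = (\<Sum>M\<in>perfect_matchings A. \<Prod>e\<in>M. G (Min e) (Max e))"

definition symmetric :: "(nat \<Rightarrow> nat \<Rightarrow> 'a) \<Rightarrow> bool" where
  "symmetric G \<longleftrightarrow> (\<forall>i j. G i j = G j i)"

lemma symmetricD: "symmetric G \<Longrightarrow> G i j = G j i"
  by (auto simp: symmetric_def)

lemma edge_cases:
  assumes "card e = 2"
  obtains a b :: "'i::linorder" where "e = {a, b}" "a < b" "Min e = a" "Max e = b"
proof -
  obtain x y where xy: "e = {x, y}" "x \<noteq> y" using assms by (auto simp: card_2_iff)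
  show ?thesis
  proof (cases "x < y")
    case True then show ?thesis using that[of x y] xy by simp
  next
    case False then show ?thesis using that[of y x] xy by (simp add: insert_commute)
  qed
qed

lemma edge_weight:
  assumes "symmetric G"
  shows "G (Min {a, b}) (Max {a, b}) = G a b"
  using symmetricD[OF assms, of a b] by (cases "a \<le> b") (simp_all add: min_def max_def)

lemma matchings_subset: "perfect_matchings A \<subseteq> Pow (Pow A)"
  by (auto simp: perfect_matchings_def)

lemma finite_matchings: "finite A \<Longrightarrow> finite (perfect_matchings A)"
  by (rule finite_subset[OF matchings_subset]) simp

lemma finite_matching: "finite A \<Longrightarrow> M \<in> perfect_matchings A \<Longrightarrow> finite M"
  using matchings_subset by (metis PowD finite_Pow_iff finite_subset subsetD)

lemma matching_eqI:
  assumes "M \<in> perfect_matchings A" "e \<in> M" "f \<in> M" "x \<in> e" "x \<in> f" shows "e = f"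
  using assms by (auto simp: perfect_matchings_def disjoint_def)

lemma matching_image:
  assumes "inj_on f A" "M \<in> perfect_matchings A"
  shows "(`) f ` M \<in> perfect_matchings (f ` A)"
proof -
  have sub: "e \<subseteq> A" if "e \<in> M" for e using assms(2) that by (auto simp: perfect_matchings_def)
  have "card (f ` e) = 2" if "e \<in> M" for e
    using card_image[OF inj_on_subset[OF assms(1) sub[OF that]]] assms(2) that by (auto simp:
        perfect_matchings_def)
  moreover have "f ` d = f ` e" if "d \<in> M" "e \<in> M" "f ` d \<inter> f ` e \<noteq> {}" for d e
  proof -
    have "d \<inter> e \<noteq> {}"
      using that(3) sub[OF that(1)] sub[OF that(2)] assms(1) by (auto simp: inj_on_def) (metis
          subsetD disjoint_iff)
    then show ?thesis using matching_eqI[OF assms(2) that(1,2)] by auto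
  qed
  moreover have "\<Union> ((`) f ` M) = f ` A" using assms(2) by (auto simp: perfect_matchings_def)
  ultimately show ?thesis
    unfolding perfect_matchings_def disjoint_def by blast
qed

lemma weight_image:
  assumes inj: "inj_on f A" and M: "M \<in> perfect_matchings A" and sym: "symmetric G"
  shows "(\<Prod>e\<in>(`) f ` M. G (Min e) (Max e)) = (\<Prod>e\<in>M. G (f (Min e)) (f (Max e)))"
proof -
  have sub: "e \<subseteq> A" if "e \<in> M" for e using M that by (auto simp: perfect_matchings_def)
  have "inj_on ((`) f) M"
    using inj sub by (auto intro!: inj_onI simp: inj_on_image_eq_iff)
  then have "(\<Prod>e\<in>(`) f ` M. G (Min e) (Max e)) = (\<Prod>e\<in>M. G (Min (f ` e)) (Max (f ` e)))"
    by (simp add: prod.reindex)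
  also have "\<dots> = (\<Prod>e\<in>M. G (f (Min e)) (f (Max e)))"
  proof (rule prod.cong)
    fix e assume "e \<in> M"
    then have "card e = 2" using M by (auto simp: perfect_matchings_def)
    then obtain a b where "e = {a, b}" "Min e = a" "Max e = b" by (rule edge_cases)
    then show "G (Min (f ` e)) (Max (f ` e)) = G (f (Min e)) (f (Max e))"
      using edge_weight[OF sym, of "f a" "f b"] by simp
  qed simp
  finally show ?thesis .
qed

text \<open>A bijection of the points carries perfect matchings to perfect matchings. Labels
  inside an edge may get reversed, which symmetry of \<open>G\<close> makes harmless.\<close>

lemma hafnian_relabel:
  assumes inj: "inj_on f A" and sym: "symmetric G"
  shows "hafnian (\<lambda>i j. G (f i) (f j)) A = hafnian G (f ` A)"
proof -
  let ?g = "inv_into A f"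
  have cancel1: "(`) ?g ` (`) f ` M = M" if "M \<in> perfect_matchings A" for M
  proof -
    have "?g ` f ` e = e" if "e \<in> M" for e
      using inv_into_image_cancel[OF inj, of e] that \<open>M \<in> perfect_matchings A\<close> by (auto simp:
          perfect_matchings_def)
    then show ?thesis by (simp add: image_image)
  qed
  have cancel2: "(`) f ` (`) ?g ` M = M" if "M \<in> perfect_matchings (f ` A)" for M
  proof -
    have "f ` ?g ` e = e" if "e \<in> M" for e
      using image_inv_into_cancel[of f A "f ` A" e] that \<open>M \<in> perfect_matchings (f ` A)\<close>
      by (auto simp: perfect_matchings_def)
    then show ?thesis by (simp add: image_image)
  qed
  have ginj: "inj_on ?g (f ` A)" by (rule inj_on_inv_into) simp
  have gim: "?g ` f ` A = A" using inj by (rule inv_into_image_cancel) simp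
  show ?thesis
    unfolding hafnian_def
    by (rule sum.reindex_bij_witness[where i = "(`) ((`) ?g)" and j = "(`) ((`) f)"])
      (use cancel1 cancel2 matching_image[OF inj] matching_image[OF ginj, unfolded gim]
          weight_image[OF inj _ sym] in auto)
qed

text \<open>The terms outside the fixed points cancel in pairs modulo 2.\<close>

lemma even_sum_involution:
  fixes F :: "'i \<Rightarrow> 'a::comm_ring_1"
  assumes "finite X"
    and "\<And>x. x \<in> X \<Longrightarrow> \<sigma> x \<in> X" "\<And>x. x \<in> X \<Longrightarrow> \<sigma> (\<sigma> x) = x" "\<And>x. x \<in> X \<Longrightarrow> F (\<sigma> x) = F x"
    and "\<And>x. x \<in> X \<Longrightarrow> \<sigma> x = x \<Longrightarrow> 2 dvd F x"
  shows "2 dvd (\<Sum>x\<in>X. F x)"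
  using assms
proof (induction X rule: finite_psubset_induct)
  case (psubset X)
  show ?case
  proof (cases "X = {}")
    case False
    then obtain x where x: "x \<in> X" by auto
    let ?Y = "X - {x, \<sigma> x}"
    have "2 dvd (\<Sum>x\<in>?Y. F x)"
    proof (rule psubset.IH)
      show "\<sigma> y \<in> ?Y" if "y \<in> ?Y" for y
        using that psubset.prems(1,2)[of y] psubset.prems(2)[of x] x by auto
    qed (use x psubset.prems in auto)
    moreover have "2 dvd (\<Sum>x\<in>{x, \<sigma> x}. F x)"
    proof (cases "\<sigma> x = x")
      case False
      then have "(\<Sum>x\<in>{x, \<sigma> x}. F x) = 2 * F x" using psubset.prems(3)[OF x] by simp
      then show ?thesis by simp
    qed (use psubset.prems(4) x in auto)
    moreover have "(\<Sum>x\<in>X. F x) = (\<Sum>x\<in>?Y. F x) + (\<Sum>x\<in>{x, \<sigma> x}. F x)"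
      using sum.subset_diff[of "{x, \<sigma> x}" X F] x psubset.prems(1)[OF x] psubset.hyps by auto
    ultimately show ?thesis by simp
  qed simp
qed

text \<open>The modulo 2 analogue of the vanishing of an alternating form at a repeated argument.
  The transposition of the two equal arguments permutes the matchings and preserves their
  weights. A matching that it fixes must contain the edge joining them, whose weight is a
  diagonal entry of \<open>G\<close> and hence even.\<close>

lemma hafnian_even_if_repeated:
  assumes fin: "finite A" and ab: "a \<in> A" "b \<in> A" "a \<noteq> b" "f a = f b"
    and sym: "symmetric G" and diag: "\<And>i. 2 dvd G i i"
  shows "2 dvd hafnian (\<lambda>i j. G (f i) (f j)) A"
proof -
  define t where "t = Transposition.transpose a b"
  have tA: "t ` A = A" unfolding t_def using ab by (auto simp: Transposition.transpose_def
      image_iff)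
  have inj: "inj_on t A" unfolding t_def by simp
  have ft: "f (t i) = f i" for i using ab by (auto simp: t_def Transposition.transpose_def)
  have sym': "symmetric (\<lambda>i j. G (f i) (f j))" using sym by (simp add: symmetric_def)
  show ?thesis
    unfolding hafnian_def
  proof (rule even_sum_involution[where \<sigma> = "(`) ((`) t)"])
    fix M assume M: "M \<in> perfect_matchings A"
    show "(`) t ` M \<in> perfect_matchings A" using matching_image[OF inj M] by (simp add: tA)
    show "(`) t ` (`) t ` M = M" by (simp add: image_image t_def)
    show "(\<Prod>e\<in>(`) t ` M. G (f (Min e)) (f (Max e))) = (\<Prod>e\<in>M. G (f (Min e)) (f (Max e)))"
      using weight_image[OF inj M sym'] by (simp add: ft)
    assume fixed: "(`) t ` M = M"
    obtain e where e: "e \<in> M" "a \<in> e" using M ab by (auto simp: perfect_matchings_def)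
    have c2: "card e = 2" using M e by (auto simp: perfect_matchings_def)
    have "e = {a, b}"
    proof (rule ccontr)
      assume ne: "e \<noteq> {a, b}"
      obtain c where c: "e = {a, c}" "c \<noteq> a" using c2 e by (auto simp: card_2_iff)
      then have "c \<noteq> b" using ne by auto
      have "t ` e \<in> M" using fixed e by blast
      moreover have "t ` e = {b, c}" using c \<open>c \<noteq> b\<close> by (auto simp: t_def
          Transposition.transpose_def)
      ultimately have "{b, c} = {a, c}" using matching_eqI[OF M e(1), of "{b, c}" c] c by auto
      then show False using ab c \<open>c \<noteq> b\<close> by (auto simp: doubleton_eq_iff)
    qed
    then have "G (f (Min e)) (f (Max e)) = G (f a) (f b)"
      using edge_weight[OF sym'] by simp
    then have "2 dvd G (f (Min e)) (f (Max e))" using ab diag by simp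
    then show "2 dvd (\<Prod>e\<in>M. G (f (Min e)) (f (Max e)))"
      by (rule dvd_trans) (rule dvd_prodI[OF finite_matching[OF fin M] e(1)])
  qed (rule finite_matchings[OF fin])
qed

lemma sum_PiE_insert:
  assumes "x \<notin> S"
  shows "(\<Sum>f\<in>PiE (insert x S) T. F f) = (\<Sum>y\<in>T x. \<Sum>g\<in>PiE S T. F (g(x := y)))"
  unfolding PiE_insert_eq
  by (subst sum.reindex[OF inj_combinator[OF assms]]) (simp add: sum.cartesian_product
      case_prod_unfold)

text \<open>The entries of \<open>U\<^sup>T G U\<close>. Index functions are used in place of matrices so that row
  and column labels of any range can be substituted.\<close>

definition base_change :: "nat \<Rightarrow> (nat \<Rightarrow> nat \<Rightarrow> 'a::comm_ring_1) \<Rightarrow> (nat \<Rightarrow> nat \<Rightarrow> 'a) \<Rightarrow> nat \<Rightarrow> nat \<Rightarrow>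
    'a" where
  "base_change n U G i j = (\<Sum>a<n. \<Sum>b<n. U a i * G a b * U b j)"

text \<open>Multilinear expansion of the weight of one matching: choosing a summand \<open>(a, b)\<close> for
  every edge is the same as choosing a value \<open>f i\<close> for every point \<open>i\<close> covered by the
  matching.\<close>

lemma prod_base_change_expand:
  assumes "finite M" "disjoint M" "\<forall>e\<in>M. card e = 2"
  shows "(\<Prod>e\<in>M. base_change n U G (Min e) (Max e)) =
    (\<Sum>f\<in>PiE (\<Union>M) (\<lambda>_. {..<n}). (\<Prod>i\<in>\<Union>M. U (f i) i) * (\<Prod>e\<in>M. G (f (Min e)) (f (Max e))))"
  using assms
proof (induction M rule: finite_induct)
  case empty
  then show ?case by simp
next
  case (insert e M)
  have "card e = 2" using insert.prems(2) by simp
  then obtain c d where e: "e = {c, d}" "c < d" "Min e = c" "Max e = d"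
    by (rule edge_cases)
  have "e \<inter> x = {}" if "x \<in> M" for x
    using insert.prems(1) insert.hyps(2) that unfolding disjoint_def by (metis insertI1 insertI2)
  then have cd: "c \<notin> \<Union>M" "d \<notin> \<Union>M" using e(1) by blast+
  have finU: "finite (\<Union>M)"
  proof (rule finite_Union[OF insert.hyps(1)])
    show "finite x" if "x \<in> M" for x using that insert.prems(2) by (intro card_ge_0_finite) simp
  qed
  have IH: "(\<Prod>e\<in>M. base_change n U G (Min e) (Max e)) =
    (\<Sum>f\<in>PiE (\<Union>M) (\<lambda>_. {..<n}). (\<Prod>i\<in>\<Union>M. U (f i) i) * (\<Prod>e\<in>M. G (f (Min e)) (f (Max e))))"
  proof (rule insert.IH)
    show "disjoint M" using insert.prems(1) by (meson disjoint_def insertI2)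
    show "\<forall>e\<in>M. card e = 2" using insert.prems(2) by simp
  qed
  let ?P = "PiE (\<Union>M) (\<lambda>_. {..<n})"
  have U: "\<Union>(insert e M) = insert c (insert d (\<Union>M))" using e by auto
  have step: "(\<Prod>i\<in>insert c (insert d (\<Union>M)). U ((g(d := b, c := a)) i) i) *
      (\<Prod>e'\<in>insert e M. G ((g(d := b, c := a)) (Min e')) ((g(d := b, c := a)) (Max e'))) =
      (U a c * G a b * U b d) * ((\<Prod>i\<in>\<Union>M. U (g i) i) * (\<Prod>e\<in>M. G (g (Min e)) (g (Max e))))"
    for a b g
  proof -
    have "(\<Prod>i\<in>insert c (insert d (\<Union>M)). U ((g(d := b, c := a)) i) i) =
        U a c * (U b d * (\<Prod>i\<in>\<Union>M. U ((g(d := b, c := a)) i) i))"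
    proof -
      have "c \<notin> insert d (\<Union>M)" "c \<noteq> d" using cd(1) e(2) by simp_all
      then show ?thesis by (simp only: prod.insert finite_insert finU cd(2) not_False_eq_True
            fun_upd_same fun_upd_other if_False)
    qed
    also have "(\<Prod>i\<in>\<Union>M. U ((g(d := b, c := a)) i) i) = (\<Prod>i\<in>\<Union>M. U (g i) i)"
    proof (rule prod.cong)
      fix i assume "i \<in> \<Union>M"
      then have "i \<noteq> c" "i \<noteq> d" using cd by blast+
      then show "U ((g(d := b, c := a)) i) i = U (g i) i" by simp
    qed simp
    finally have 1: "(\<Prod>i\<in>insert c (insert d (\<Union>M)). U ((g(d := b, c := a)) i) i) =
        U a c * (U b d * (\<Prod>i\<in>\<Union>M. U (g i) i))" .
    have 2: "(\<Prod>e\<in>M. G ((g(d := b, c := a)) (Min e)) ((g(d := b, c := a)) (Max e))) =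
        (\<Prod>e\<in>M. G (g (Min e)) (g (Max e)))"
    proof (rule prod.cong)
      fix x assume x: "x \<in> M"
      have "card x = 2" using x insert.prems by auto
      then obtain p q where "x = {p, q}" "Min x = p" "Max x = q" by (rule edge_cases)
      then have "Min x \<in> \<Union>M" "Max x \<in> \<Union>M" using x by blast+
      then have "Min x \<noteq> c" "Min x \<noteq> d" "Max x \<noteq> c" "Max x \<noteq> d" using cd by blast+
      then show "G ((g(d := b, c := a)) (Min x)) ((g(d := b, c := a)) (Max x)) = G (g (Min x)) (g
          (Max x))"
        by simp
    qed simp
    have 3: "G ((g(d := b, c := a)) (Min e)) ((g(d := b, c := a)) (Max e)) = G a b"
      using e(2) unfolding e(3,4) by simp
    show ?thesis unfolding 1 prod.insert[OF insert.hyps] 2 3 by (simp only: mult_ac)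
  qed
  have "(\<Prod>e\<in>insert e M. base_change n U G (Min e) (Max e)) =
      (\<Sum>a<n. \<Sum>b<n. U a c * G a b * U b d) *
      (\<Sum>g\<in>?P. (\<Prod>i\<in>\<Union>M. U (g i) i) * (\<Prod>e\<in>M. G (g (Min e)) (g (Max e))))"
    unfolding prod.insert[OF insert.hyps] IH e(3,4) base_change_def[of n U G c d] ..
  also have "\<dots> = (\<Sum>a<n. \<Sum>b<n. \<Sum>g\<in>?P.
      (U a c * G a b * U b d) * ((\<Prod>i\<in>\<Union>M. U (g i) i) * (\<Prod>e\<in>M. G (g (Min e)) (g (Max e)))))"
    by (simp only: sum_distrib_right) (simp only: sum_distrib_left)
  also have "\<dots> = (\<Sum>f\<in>PiE (\<Union>(insert e M)) (\<lambda>_. {..<n}).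
      (\<Prod>i\<in>\<Union>(insert e M). U (f i) i) * (\<Prod>e\<in>insert e M. G (f (Min e)) (f (Max e))))"
  proof -
    have c: "c \<notin> insert d (\<Union>M)" using cd e(2) by simp
    show ?thesis
      unfolding U by (simp only: sum_PiE_insert[OF cd(2)] sum_PiE_insert[OF c] step)
  qed
  finally show ?case .
qed

lemma hafnian_base_change_expand:
  "hafnian (base_change n U G) {0..<n} =
    (\<Sum>f\<in>PiE {0..<n} (\<lambda>_. {..<n}). (\<Prod>i\<in>{0..<n}. U (f i) i) * hafnian (\<lambda>i j. G (f i) (f j)) {0..<n})"
proof -
  have "hafnian (base_change n U G) {0..<n} = (\<Sum>M\<in>perfect_matchings {0..<n}. \<Sum>f\<in>PiE {0..<n} (\<lambda>_.
      {..<n}).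
      (\<Prod>i\<in>{0..<n}. U (f i) i) * (\<Prod>e\<in>M. G (f (Min e)) (f (Max e))))"
    unfolding hafnian_def
  proof (rule sum.cong)
    fix M assume M: "M \<in> perfect_matchings {0..<n}"
    then have "\<Union>M = {0..<n}" "disjoint M" "\<forall>e\<in>M. card e = 2" by (auto simp: perfect_matchings_def)
    then show "(\<Prod>e\<in>M. base_change n U G (Min e) (Max e)) = (\<Sum>f\<in>PiE {0..<n} (\<lambda>_. {..<n}).
      (\<Prod>i\<in>{0..<n}. U (f i) i) * (\<Prod>e\<in>M. G (f (Min e)) (f (Max e))))"
      using prod_base_change_expand[of M n U G] finite_matching[OF _ M] by simp
  qed simp
  then show ?thesis
    by (subst (asm) sum.swap) (simp add: hafnian_def sum_distrib_left)
qed

abbreviation mat_of :: "nat \<Rightarrow> (nat \<Rightarrow> nat \<Rightarrow> 'a) \<Rightarrow> 'a mat" where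
  "mat_of n G \<equiv> mat n n (\<lambda>(i, j). G i j)"

lemma restrict_permutations:
  assumes "finite A"
  shows "bij_betw (\<lambda>p. restrict p A) {p. p permutes A} {f \<in> A \<rightarrow>\<^sub>E A. inj_on f A}"
proof (rule bij_betwI')
  fix p q assume pq: "p \<in> {p. p permutes A}" "q \<in> {p. p permutes A}"
  show "(restrict p A = restrict q A) = (p = q)"
  proof
    assume eq: "restrict p A = restrict q A"
    show "p = q"
    proof
      fix x show "p x = q x"
        using pq fun_cong[OF eq, of x] permutes_not_in[of p A x] permutes_not_in[of q A x]
        by (cases "x \<in> A") simp_all
    qed
  qed simp
next
  fix p assume p: "p \<in> {p. p permutes A}"
  then have "p x \<in> A" if "x \<in> A" for x using that permutes_in_image[of p A x] by simp
  moreover have "inj_on p A" using p by (simp add: permutes_inj_on)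
  ultimately show "restrict p A \<in> {f \<in> A \<rightarrow>\<^sub>E A. inj_on f A}" by simp
next
  fix f assume f: "f \<in> {f \<in> A \<rightarrow>\<^sub>E A. inj_on f A}"
  define p where "p = (\<lambda>x. if x \<in> A then f x else x)"
  have "f ` A = A"
    using f by (intro card_subset_eq assms) (auto simp: card_image)
  then have "bij_betw f A A" using f by (simp add: bij_betw_def)
  then have "bij_betw p A A" using bij_betw_cong[of A p f A] by (simp add: p_def)
  then have "p permutes A" by (rule bij_imp_permutes) (simp add: p_def)
  moreover have "f = restrict p A"
  proof
    fix x show "f x = restrict p A x"
      using f PiE_arb[of f A "\<lambda>_. A" x] by (cases "x \<in> A") (simp_all add: p_def)
  qed
  ultimately show "\<exists>p\<in>{p. p permutes A}. f = restrict p A" by blast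
qed

text \<open>In the expansion over all maps \<open>f\<close>, the terms with non-injective \<open>f\<close> have an even
  hafnian by the lemma on repeated arguments, and the others see the unchanged hafnian of
  \<open>G\<close>. What remains is the permanent of \<open>U\<close>, and signs do not matter modulo 2.\<close>

lemma hafnian_base_change_mod_2:
  fixes G :: "nat \<Rightarrow> nat \<Rightarrow> 'a::comm_ring_1"
  assumes sym: "symmetric G" and diag: "\<And>i. 2 dvd G i i"
  shows "2 dvd hafnian (base_change n U G) {0..<n} - det (mat_of n U) * hafnian G {0..<n}"
proof -
  let ?A = "{0..<n}"
  let ?P = "?A \<rightarrow>\<^sub>E ?A"
  let ?I = "{f \<in> ?P. inj_on f ?A}"
  define w where "w f = (\<Prod>i\<in>?A. U (f i) i)" for f
  define T where "T f = w f * hafnian (\<lambda>i j. G (f i) (f j)) ?A" for f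
  have finP: "finite ?P" by (intro finite_PiE) auto
  have noninj: "2 dvd (\<Sum>f\<in>?P - ?I. T f)"
  proof (rule dvd_sum)
    fix f assume "f \<in> ?P - ?I"
    then obtain a b where ab: "a \<in> ?A" "b \<in> ?A" "a \<noteq> b" "f a = f b" by (auto simp: inj_on_def)
    show "2 dvd T f"
      unfolding T_def by (intro dvd_mult hafnian_even_if_repeated[where A = ?A, OF _ ab sym diag])
          simp
  qed
  have "T f = w f * hafnian G ?A" if f: "f \<in> ?I" for f
  proof -
    have "f ` ?A = ?A"
      using f by (intro card_subset_eq) (auto simp: card_image)
    then show ?thesis using hafnian_relabel[OF _ sym, of f ?A] f by (simp add: T_def)
  qed
  then have "(\<Sum>f\<in>?I. T f) = (\<Sum>f\<in>?I. w f) * hafnian G ?A"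
    by (simp add: sum_distrib_right)
  also have "(\<Sum>f\<in>?I. w f) = (\<Sum>p | p permutes ?A. w (restrict p ?A))"
    by (rule sum.reindex_bij_betw[symmetric, OF restrict_permutations]) simp
  also have "\<dots> = (\<Sum>p | p permutes ?A. w p)"
    by (simp add: w_def)
  finally have inj: "(\<Sum>f\<in>?I. T f) = (\<Sum>p | p permutes ?A. w p) * hafnian G ?A" .
  have det: "2 dvd det (mat_of n U) - (\<Sum>p | p permutes ?A. w p)"
  proof -
    have "det (mat_of n U) = (\<Sum>p | p permutes ?A. signof p * (\<Prod>j<n. mat_of n U $$ (p j, j)))"
      by (rule det_col) simp
    also have "\<dots> = (\<Sum>p | p permutes ?A. signof p * w p)"
    proof (rule sum.cong)
      fix p assume "p \<in> {p. p permutes ?A}"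
      then have "p j < n" if "j < n" for j using permutes_in_image[of p ?A j] that by simp
      then have "(\<Prod>j<n. mat_of n U $$ (p j, j)) = w p"
        unfolding w_def lessThan_atLeast0 by (intro prod.cong) simp_all
      then show "signof p * (\<Prod>j<n. mat_of n U $$ (p j, j)) = signof p * w p" by simp
    qed simp
    finally have "det (mat_of n U) - (\<Sum>p | p permutes ?A. w p) = (\<Sum>p | p permutes ?A. signof p * w
        p - w p)"
      by (simp add: sum_subtractf)
    moreover have "2 dvd signof p * w p - w p" for p
    proof (cases p rule: sign_cases)
      case even
      then show ?thesis by simp
    next
      case odd
      then have "signof p * w p - w p = 2 * (- w p)" by simp
      then show ?thesis by (metis dvd_triv_left)
    qed
    ultimately show ?thesis by (simp add: dvd_sum)
  qed
  have "{..<n} = ?A" by auto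
  then have "hafnian (base_change n U G) ?A = (\<Sum>f\<in>?P. T f)"
    unfolding hafnian_base_change_expand T_def w_def by simp
  also have "\<dots> = (\<Sum>f\<in>?P - ?I. T f) + (\<Sum>f\<in>?I. T f)"
    by (rule sum.subset_diff[OF Collect_restrict finP])
  finally have "hafnian (base_change n U G) ?A - det (mat_of n U) * hafnian G ?A =
     (\<Sum>f\<in>?P - ?I. T f) - (det (mat_of n U) - (\<Sum>p | p permutes ?A. w p)) * hafnian G ?A"
    unfolding inj by (simp add: algebra_simps)
  then show ?thesis using dvd_diff[OF noninj dvd_mult2[OF det]] by (simp only:)
qed

text \<open>If the point \<open>a\<close> pairs nontrivially with \<open>b\<close> only, then only matchings containing that
  edge contribute.\<close>

lemma hafnian_split_edge:
  assumes fin: "finite B" and ab: "a \<noteq> b" "a \<notin> B" "b \<notin> B"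
    and sym: "symmetric G" and zero: "\<And>j. j \<in> B \<Longrightarrow> G a j = 0"
  shows "hafnian G (insert a (insert b B)) = G a b * hafnian G B"
proof -
  let ?A = "insert a (insert b B)"
  let ?w = "\<lambda>M. \<Prod>e\<in>M. G (Min e) (Max e)"
  let ?N = "{M \<in> perfect_matchings ?A. {a, b} \<in> M}"
  have finM: "finite (perfect_matchings ?A)" using fin by (intro finite_matchings) simp
  have "?w M = 0" if M: "M \<in> perfect_matchings ?A - ?N" for M
  proof -
    obtain e where e: "e \<in> M" "a \<in> e" using M by (auto simp: perfect_matchings_def)
    have "card e = 2" "e \<subseteq> ?A" using M e by (auto simp: perfect_matchings_def)
    then obtain c where c: "e = {a, c}" "c \<noteq> a" using e by (auto simp: card_2_iff)
    then have "c \<in> B" using e M \<open>e \<subseteq> ?A\<close> by auto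
    then have "G (Min e) (Max e) = 0" using edge_weight[OF sym, of a c] zero c by simp
    moreover have "finite M" using M fin by (intro finite_matching[of ?A]) auto
    ultimately show ?thesis using e(1) by (intro prod_zero) auto
  qed
  then have "hafnian G ?A = (\<Sum>M\<in>?N. ?w M)"
    unfolding hafnian_def by (intro sum.mono_neutral_right[OF finM]) auto
  also have "\<dots> = (\<Sum>M\<in>perfect_matchings B. G a b * ?w M)"
  proof (rule sum.reindex_bij_witness[where j = "\<lambda>M. M - {{a, b}}" and i = "insert {a, b}"])
    fix M assume M: "M \<in> ?N"
    then show "insert {a, b} (M - {{a, b}}) = M" by auto
    have "\<Union>(M - {{a, b}}) = B"
    proof -
      have "e \<subseteq> B" if "e \<in> M" "e \<noteq> {a, b}" for e
      proof -
        have "a \<notin> e" "b \<notin> e" using matching_eqI[of M ?A e "{a, b}"] M that by blast+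
        then show ?thesis using M that by (auto simp: perfect_matchings_def)
      qed
      moreover have "\<Union>M = ?A" using M by (auto simp: perfect_matchings_def)
      ultimately show ?thesis using ab by (auto) blast
    qed
    then show "M - {{a, b}} \<in> perfect_matchings B"
      using M by (auto simp: perfect_matchings_def disjoint_def)
    have "finite M" using M fin by (intro finite_matching[of ?A]) auto
    then show "G a b * ?w (M - {{a, b}}) = ?w M"
      using M prod.remove[of M "{a, b}" "\<lambda>e. G (Min e) (Max e)"] edge_weight[OF sym, of a b] by simp
  next
    fix M assume M: "M \<in> perfect_matchings B"
    then have "{a, b} \<notin> M" using ab by (auto simp: perfect_matchings_def)
    then show "insert {a, b} M - {{a, b}} = M" by simp
    show "insert {a, b} M \<in> ?N"
      using M ab by (auto simp: perfect_matchings_def disjoint_def)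
  qed
  finally show ?thesis by (simp add: hafnian_def sum_distrib_left)
qed

lemma hafnian_even_if_even:
  assumes A: "finite A" "A \<noteq> {}" and even: "\<And>i j. i \<in> A \<Longrightarrow> j \<in> A \<Longrightarrow> i \<noteq> j \<Longrightarrow> 2 dvd G i j"
  shows "2 dvd hafnian G A"
  unfolding hafnian_def
proof (rule dvd_sum)
  fix M assume M: "M \<in> perfect_matchings A"
  then obtain e where e: "e \<in> M" using A by (auto simp: perfect_matchings_def)
  have "card e = 2" "e \<subseteq> A" using M e by (auto simp: perfect_matchings_def)
  then obtain a b where "e = {a, b}" "a < b" "Min e = a" "Max e = b" by (metis edge_cases)
  then have "2 dvd G (Min e) (Max e)" using even \<open>e \<subseteq> A\<close> by auto
  then show "2 dvd (\<Prod>e\<in>M. G (Min e) (Max e))"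
    by (rule dvd_trans) (rule dvd_prodI[OF finite_matching[OF A(1) M] e(1)])
qed

lemma hom_hafnian:
  assumes "comm_ring_hom f" shows "f (hafnian G A) = hafnian (\<lambda>i j. f (G i j)) A"
proof -
  interpret comm_ring_hom f by fact
  show ?thesis by (simp add: hafnian_def hom_sum hom_prod)
qed

text \<open>The Gram matrix of the standard basis for the form \<open>\<Sum> x\<^sub>t y\<^sub>t\<close>.\<close>

definition hyperbolic :: "nat \<Rightarrow> nat \<Rightarrow> nat \<Rightarrow> 'a::comm_ring_1" where
  "hyperbolic \<nu> i j = (if (i < \<nu> \<and> j = \<nu> + i) \<or> (j < \<nu> \<and> i = \<nu> + j) then 1 else 0)"

lemma symmetric_hyperbolic: "symmetric (hyperbolic \<nu>)"
  by (auto simp: symmetric_def hyperbolic_def)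

text \<open>Every point has a unique partner with nonzero pairing, so a single matching
  contributes.\<close>

lemma hafnian_hyperbolic: "hafnian (hyperbolic \<nu>) {0..<2 * \<nu>} = 1"
proof -
  let ?w = "\<lambda>M. \<Prod>e\<in>M. hyperbolic \<nu> (Min e) (Max e) :: 'a"
  let ?E = "\<lambda>t. {t, \<nu> + t}"
  let ?M = "?E ` {..<\<nu>}"
  have cov: "t \<in> (\<Union>t<\<nu>. ?E t)" if "t < 2 * \<nu>" for t
  proof (cases "t < \<nu>")
    case False
    then have "t \<in> ?E (t - \<nu>)" "t - \<nu> < \<nu>" using that by auto
    then show ?thesis by blast
  qed auto
  have mem: "?M \<in> perfect_matchings {0..<2 * \<nu>}"
  proof -
    have "\<Union>?M = {0..<2 * \<nu>}"
    proof
      show "{0..<2 * \<nu>} \<subseteq> \<Union>?M" using cov by (intro subsetI) simp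
    qed auto
    then show ?thesis
      by (auto simp: perfect_matchings_def disjoint_def card_insert_if)
  qed
  have "?w M = 0" if M: "M \<in> perfect_matchings {0..<2 * \<nu>} - {?M}" for M
  proof (rule ccontr)
    assume nz: "?w M \<noteq> 0"
    have finM: "finite M" using M by (intro finite_matching[of "{0..<2 * \<nu>}"]) auto
    have sub: "M \<subseteq> ?M"
    proof
      fix e assume e: "e \<in> M"
      have "hyperbolic \<nu> (Min e) (Max e) \<noteq> (0 :: 'a)"
        using nz prod_zero[OF finM, of "\<lambda>e. hyperbolic \<nu> (Min e) (Max e) :: 'a"] e by blast
      moreover have "card e = 2" using M e by (auto simp: perfect_matchings_def)
      then obtain a b where "e = {a, b}" "a < b" "Min e = a" "Max e = b" by (rule edge_cases)
      ultimately show "e \<in> ?M" by (auto simp: hyperbolic_def split: if_splits)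
    qed
    moreover have "?M \<subseteq> M"
    proof
      fix e assume e: "e \<in> ?M"
      then obtain t where t: "t \<in> e" "t < 2 * \<nu>" by fastforce
      then have "t \<in> \<Union>M" using M by (simp add: perfect_matchings_def)
      then obtain e' where e': "e' \<in> M" "t \<in> e'" by blast
      then have "e' = e" using matching_eqI[OF mem, of e' e t] sub e t by blast
      then show "e \<in> M" using e' by simp
    qed
    ultimately show False using M by auto
  qed
  then have "hafnian (hyperbolic \<nu>) {0..<2 * \<nu>} = ?w ?M"
    unfolding hafnian_def using mem
    by (subst sum.mono_neutral_right[where S = "{?M}"]) (auto intro: finite_matchings)
  also have "\<dots> = 1"
    by (rule prod.neutral) (auto simp: hyperbolic_def min_def max_def)
  finally show ?thesis .
qed

section \<open>Determinant and hafnian of an even symmetric matrix modulo 4\<close>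

lemma symmetric_base_change:
  assumes "symmetric G" shows "symmetric (base_change n U G)"
  unfolding symmetric_def
proof (intro allI)
  fix i j
  have "base_change n U G i j = (\<Sum>b<n. \<Sum>a<n. U a i * G a b * U b j)"
    unfolding base_change_def by (rule sum.swap)
  also have "\<dots> = base_change n U G j i"
    unfolding base_change_def using symmetricD[OF assms] by (intro sum.cong) (simp_all add: mult_ac)
  finally show "base_change n U G i j = base_change n U G j i" .
qed

text \<open>The off-diagonal terms come in equal pairs.\<close>

lemma even_sym_double_sum:
  fixes F :: "nat \<Rightarrow> nat \<Rightarrow> 'a::comm_ring_1"
  assumes "\<And>a b. F a b = F b a" "\<And>a. 2 dvd F a a"
  shows "2 dvd (\<Sum>a<n. \<Sum>b<n. F a b)"
proof (induction n)
  case (Suc n)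
  have "(\<Sum>a<n. F n a) = (\<Sum>a<n. F a n)" using assms(1)[of n] by (intro sum.cong) simp_all
  then have "(\<Sum>a<Suc n. \<Sum>b<Suc n. F a b) =
      (\<Sum>a<n. \<Sum>b<n. F a b) + (2 * (\<Sum>a<n. F a n) + F n n)"
    by (simp add: sum.distrib)
  then show ?case using Suc.IH assms(2)[of n] by (simp only: dvd_add dvd_triv_left)
qed simp

lemma even_diag_base_change:
  assumes "symmetric G" "\<And>i. 2 dvd G i i" shows "2 dvd base_change n U G i i"
  unfolding base_change_def
  by (rule even_sym_double_sum) (use symmetricD[OF assms(1)] assms(2) in \<open>auto simp: mult_ac\<close>)

lemma mat_of_base_change:
  "mat_of n (base_change n U G) = transpose_mat (mat_of n U) * mat_of n G * mat_of n U"
  by (rule eq_matI)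
    (auto simp: base_change_def scalar_prod_def lessThan_atLeast0 sum_distrib_right intro: sum.swap)

lemma det_base_change: "det (mat_of n (base_change n U G)) = det (mat_of n U) ^ 2 * det (mat_of n
    G)"
proof -
  have "det (mat_of n (base_change n U G)) = det (transpose_mat (mat_of n U) * mat_of n G) * det
      (mat_of n U)"
    unfolding mat_of_base_change by (rule det_mult[of _ n]) (auto intro!: mult_carrier_mat[of _ n
        n])
  also have "det (transpose_mat (mat_of n U) * mat_of n G) = det (transpose_mat (mat_of n U)) *
      det (mat_of n G)"
    by (rule det_mult[of _ n]) simp_all
  also have "det (transpose_mat (mat_of n U)) = det (mat_of n U)"
    by (rule det_transpose[of _ n]) simp
  finally show ?thesis by (simp add: power2_eq_square mult_ac)
qed

lemma cong_4_of_cong_2: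
  fixes x y :: "'a::comm_ring_1"
  assumes "2 dvd x - y" shows "4 dvd x ^ 2 - y ^ 2"
proof -
  obtain r where "x - y = 2 * r" using assms ..
  then have x: "x = y + 2 * r" by (simp add: algebra_simps)
  have "x ^ 2 - y ^ 2 = 4 * (r * y + r ^ 2)"
    unfolding x by (simp add: power2_eq_square algebra_simps)
  then show ?thesis by (rule dvdI)
qed

text \<open>The quotient \<open>((-1)\<^sup>\<nu> det G - haf(G)\<^sup>2) / 4\<close> generalises, up to sign, the product
  \<open>q(v\<^sub>1) q(v\<^sub>2)\<close> obtained for two vectors; it is the source of the constant term in the
  equation for \<open>\<Delta>\<close>.\<close>

definition hafnian_cong_4 :: "nat \<Rightarrow> (nat \<Rightarrow> nat \<Rightarrow> 'a::idom) \<Rightarrow> bool" where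
  "hafnian_cong_4 \<nu> G \<longleftrightarrow> 4 dvd (-1) ^ \<nu> * det (mat_of (2 * \<nu>) G) - hafnian G {0..<2 * \<nu>} ^ 2"

text \<open>Cancels an odd factor twice, once for each factor 2.\<close>

lemma four_dvd_cancel_odd:
  fixes d x :: "'a::idom"
  assumes two: "prime_elem (2 :: 'a)"
    and odd: "\<not> 2 dvd d" and dvd: "4 dvd d * x"
  shows "4 dvd x"
proof -
  have four: "(4 :: 'a) = 2 * 2" by simp
  have "2 dvd d * x" using dvd unfolding four by (rule dvd_mult_left)
  then obtain y where y: "x = 2 * y" using prime_elem_dvd_multD[OF two] odd by (meson dvdE)
  have "2 * 2 dvd 2 * (d * y)" using dvd unfolding four y by (simp only: mult_ac)
  then have "2 dvd d * y" using prime_elem_not_zeroI[OF two] by (subst (asm) dvd_mult_cancel_left)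
      simp
  then obtain z where "y = 2 * z" using prime_elem_dvd_multD[OF two] odd by (meson dvdE)
  then show ?thesis unfolding y by simp
qed

text \<open>Both sides of the congruence get multiplied by the odd element \<open>(det U)\<^sup>2\<close>: the
  determinant exactly, the square of the hafnian modulo 4 because the hafnian is known
  modulo 2.\<close>

lemma hafnian_cong_4_of_base_change:
  fixes G :: "nat \<Rightarrow> nat \<Rightarrow> 'a::idom"
  assumes two: "prime_elem (2 :: 'a)"
    and sym: "symmetric G" and diag: "\<And>i. 2 dvd G i i"
    and odd: "\<not> 2 dvd det (mat_of (2 * \<nu>) U)" and cong_4: "hafnian_cong_4 \<nu> (base_change (2 * \<nu>) U
        G)"
  shows "hafnian_cong_4 \<nu> G"
proof -
  let ?d = "det (mat_of (2 * \<nu>) U)"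
  let ?D = "(-1) ^ \<nu> * det (mat_of (2 * \<nu>) G)" and ?h = "hafnian G {0..<2 * \<nu>}"
  let ?h' = "hafnian (base_change (2 * \<nu>) U G) {0..<2 * \<nu>}"
  have "4 dvd ?h' ^ 2 - (?d * ?h) ^ 2"
    by (rule cong_4_of_cong_2) (rule hafnian_base_change_mod_2[OF sym diag])
  then have "4 dvd (((-1) ^ \<nu> * (?d ^ 2 * det (mat_of (2 * \<nu>) G))) - ?h' ^ 2) + (?h' ^ 2 - (?d *
      ?h) ^ 2)"
    using cong_4 unfolding hafnian_cong_4_def det_base_change by (rule dvd_add[rotated])
  also have "\<dots> = ?d ^ 2 * (?D - ?h ^ 2)"
    by (simp add: algebra_simps power_mult_distrib)
  finally have "4 dvd ?d ^ 2 * (?D - ?h ^ 2)" .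
  moreover have "\<not> 2 dvd ?d ^ 2" using prime_elem_dvd_multD[OF two, of ?d ?d] odd by (auto simp:
      power2_eq_square)
  ultimately show ?thesis unfolding hafnian_cong_4_def using four_dvd_cancel_odd[OF two] by blast
qed

lemma hafnian_cong:
  assumes "\<And>i j. i \<in> A \<Longrightarrow> j \<in> A \<Longrightarrow> G i j = H i j"
  shows "hafnian G A = hafnian H A"
  unfolding hafnian_def
proof (intro sum.cong prod.cong refl)
  fix M e assume M: "M \<in> perfect_matchings A" and e: "e \<in> M"
  then have "card e = 2" "e \<subseteq> A" by (auto simp: perfect_matchings_def)
  moreover from this(1) obtain a b where "e = {a, b}" "a < b" "Min e = a" "Max e = b" by (rule
      edge_cases)
  ultimately show "G (Min e) (Max e) = H (Min e) (Max e)" using assms by auto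
qed

lemma hafnian_cong_4_cong:
  assumes "\<And>i j. i < 2 * \<nu> \<Longrightarrow> j < 2 * \<nu> \<Longrightarrow> G i j = H i j"
  shows "hafnian_cong_4 \<nu> G = hafnian_cong_4 \<nu> H"
proof -
  have "mat_of (2 * \<nu>) G = mat_of (2 * \<nu>) H" by (rule eq_matI) (simp_all add: assms)
  moreover have "hafnian G {0..<2 * \<nu>} = hafnian H {0..<2 * \<nu>}" by (rule hafnian_cong) (simp add:
      assms)
  ultimately show ?thesis by (simp add: hafnian_cong_4_def)
qed

lemma hafnian_empty [simp]: "hafnian G {} = 1"
proof -
  have "M = {}" if "M \<in> perfect_matchings {}" for M :: "nat set set"
  proof (rule ccontr)
    assume "M \<noteq> {}"
    then obtain e where "e \<in> M" by blast
    then have "e = {}" "card e = 2" using that by (auto simp: perfect_matchings_def)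
    then show False by simp
  qed
  then have "perfect_matchings {} = {{} :: nat set set}"
    by (auto simp: perfect_matchings_def disjoint_def)
  then show ?thesis by (simp add: hafnian_def)
qed

lemma base_change_unit_col:
  assumes "\<And>a. a < n \<Longrightarrow> U a i = (if a = k then 1 else 0)" "k < n"
  shows "base_change n U G i j = (\<Sum>b<n. G k b * U b j)"
proof -
  have "base_change n U G i j = (\<Sum>a<n. if a = k then (\<Sum>b<n. G k b * U b j) else 0)"
    unfolding base_change_def by (rule sum.cong) (simp_all add: assms)
  then show ?thesis using assms(2) by simp
qed

lemma base_change_unit_cols:
  assumes "\<And>a. a < n \<Longrightarrow> U a i = (if a = k then 1 else 0)" "k < n"
    and "\<And>a. a < n \<Longrightarrow> U a j = (if a = l then 1 else 0)" "l < n"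
  shows "base_change n U G i j = G k l"
proof -
  have "base_change n U G i j = (\<Sum>b<n. G k b * U b j)" using assms(1,2) by (rule
      base_change_unit_col)
  also have "\<dots> = (\<Sum>b<n. if b = l then G k b else 0)" by (rule sum.cong) (simp_all add: assms(3))
  finally have "base_change n U G i j = (\<Sum>b<n. if b = l then G k b else 0)" .
  then show ?thesis using assms(4) by simp
qed

text \<open>A permutation matrix \<open>U\<close> satisfies \<open>U\<^sup>T U = 1\<close>, so \<open>(det U)\<^sup>2 = 1\<close> and \<open>det U\<close> is
  odd.\<close>

lemma hafnian_cong_4_permute:
  fixes G :: "nat \<Rightarrow> nat \<Rightarrow> 'a::idom"
  assumes two: "prime_elem (2 :: 'a)"
    and sym: "symmetric G" and diag: "\<And>i. 2 dvd G i i"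
    and p: "p permutes {0..<2 * \<nu>}" and cong_4: "hafnian_cong_4 \<nu> (\<lambda>i j. G (p i) (p j))"
  shows "hafnian_cong_4 \<nu> G"
proof -
  let ?n = "2 * \<nu>"
  define U where "U i j = (if i = p j then 1 else 0 :: 'a)" for i j
  have lt: "p i < ?n" if "i < ?n" for i using that permutes_in_image[OF p, of i] by simp
  have base_change: "base_change ?n U H i j = H (p i) (p j)" if "i < ?n" "j < ?n" for H i j
    using that lt by (intro base_change_unit_cols) (simp_all add: U_def)
  have "mat_of ?n (base_change ?n U (\<lambda>i j. if i = j then 1 else 0)) = 1\<^sub>m ?n"
    by (rule eq_matI) (use permutes_inj[OF p] in \<open>simp_all add: base_change inj_eq\<close>)
  moreover have "mat_of ?n (\<lambda>i j. if i = j then 1 else 0 :: 'a) = 1\<^sub>m ?n"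
    by (rule eq_matI) simp_all
  ultimately have "det (mat_of ?n U) ^ 2 = 1"
    using det_base_change[of ?n U "\<lambda>i j. if i = j then 1 else 0"] by simp
  then have "\<not> 2 dvd det (mat_of ?n U)"
    using prime_elem_not_unit[OF two] by (metis dvd_mult2 power2_eq_square)
  moreover have "hafnian_cong_4 \<nu> (base_change ?n U G)"
    using cong_4 by (subst hafnian_cong_4_cong[where H = "\<lambda>i j. G (p i) (p j)"]) (simp_all add:
        base_change)
  ultimately show ?thesis using hafnian_cong_4_of_base_change[OF two sym diag] by blast
qed

lemma det_2x2: "det (mat_of 2 G) = G 0 0 * G 1 1 - G 0 1 * G 1 0"
proof -
  have del: "mat_delete (mat_of 2 G) 0 j \<in> carrier_mat 1 1" for j
    using mat_delete_carrier[of "mat_of 2 G" 2 2 0 j] by simp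
  have "det (mat_of 2 G) = (\<Sum>j<2. mat_of 2 G $$ (0, j) * cofactor (mat_of 2 G) 0 j)"
    by (rule laplace_expansion_row) simp_all
  also have "\<dots> = G 0 0 * G 1 1 - G 0 1 * G 1 0"
    by (simp add: numeral_2_eq_2 cofactor_def det_single[OF del[unfolded numeral_2_eq_2]]) (simp
        add: mat_delete_def)
  finally show ?thesis .
qed

text \<open>A plane orthogonal to the remaining vectors contributes the factors \<open>4 x y - b\<^sup>2\<close> to
  the determinant and \<open>b\<close> to the hafnian, where \<open>b = H 0 1\<close>. Modulo 4 the first is \<open>- b\<^sup>2\<close>,
  and the minus sign accounts for the step from \<open>\<nu>\<close> to \<open>Suc \<nu>\<close>.\<close>

lemma hafnian_cong_4_split_plane:
  fixes H :: "nat \<Rightarrow> nat \<Rightarrow> 'a::idom"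
  assumes sym: "symmetric H" and H00: "H 0 0 = 2 * x" and H11: "H 1 1 = 2 * y"
    and perp: "\<And>j. 2 \<le> j \<Longrightarrow> j < 2 * Suc \<nu> \<Longrightarrow> H 0 j = 0 \<and> H 1 j = 0"
    and cong_4: "hafnian_cong_4 \<nu> (\<lambda>i j. H (i + 2) (j + 2))"
  shows "hafnian_cong_4 (Suc \<nu>) H"
proof -
  let ?K = "\<lambda>i j. H (i + 2) (j + 2)" and ?n = "2 * \<nu>"
  have perp': "H i j = 0 \<and> H j i = 0" if "i < 2" "2 \<le> j" "j < 2 * Suc \<nu>" for i j
    using that perp[of j] symmetricD[OF sym, of j i] by (auto simp: less_2_cases_iff)
  have "mat_of (2 * Suc \<nu>) H = four_block_mat (mat_of 2 H) (0\<^sub>m 2 ?n) (0\<^sub>m ?n 2) (mat_of ?n ?K)"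
  proof (rule eq_matI)
    fix i j
    assume "i < dim_row (four_block_mat (mat_of 2 H) (0\<^sub>m 2 ?n) (0\<^sub>m ?n 2) (mat_of ?n ?K))"
      and "j < dim_col (four_block_mat (mat_of 2 H) (0\<^sub>m 2 ?n) (0\<^sub>m ?n 2) (mat_of ?n ?K))"
    then have ij: "i < 2 * Suc \<nu>" "j < 2 * Suc \<nu>" by simp_all
    have shift: "k - 2 + 2 = k" if "\<not> k < 2" for k :: nat using that by simp
    show "mat_of (2 * Suc \<nu>) H $$ (i, j) =
        four_block_mat (mat_of 2 H) (0\<^sub>m 2 ?n) (0\<^sub>m ?n 2) (mat_of ?n ?K) $$ (i, j)"
      using ij perp'[of i j] perp'[of j i] by (auto simp del: add_2_eq_Suc' simp: shift)
  qed simp_all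
  then have "det (mat_of (2 * Suc \<nu>) H) = det (mat_of 2 H) * det (mat_of ?n ?K)"
    by (simp only:) (rule det_four_block_mat_lower_left_zero[of _ 2 _ ?n]; simp)
  also have "det (mat_of 2 H) = 4 * (x * y) - H 0 1 ^ 2"
    using symmetricD[OF sym, of 1 0] by (simp add: det_2x2 H00 H11[unfolded One_nat_def]
        power2_eq_square)
  finally have det: "det (mat_of (2 * Suc \<nu>) H) = (4 * (x * y) - H 0 1 ^ 2) * det (mat_of ?n ?K)" .
  have "{0..<2 * Suc \<nu>} = insert 0 (insert 1 {2..<2 * Suc \<nu>})" by auto
  then have "hafnian H {0..<2 * Suc \<nu>} = H 0 1 * hafnian H {2..<2 * Suc \<nu>}"
    using perp by (simp only:) (rule hafnian_split_edge[OF _ _ _ _ sym]; simp)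
  also have "{2..<2 * Suc \<nu>} = (\<lambda>i. i + 2) ` {0..<?n}" by (simp only: image_add_atLeastLessThan')
      (simp add: numeral_2_eq_2)
  also have "hafnian H \<dots> = hafnian ?K {0..<?n}" by (rule hafnian_relabel[OF _ sym, symmetric])
      (rule inj_on_add')
  finally have haf: "hafnian H {0..<2 * Suc \<nu>} = H 0 1 * hafnian ?K {0..<?n}" .
  obtain r where "(-1) ^ \<nu> * det (mat_of ?n ?K) - hafnian ?K {0..<?n} ^ 2 = 4 * r"
    using cong_4 unfolding hafnian_cong_4_def ..
  then have r: "(-1) ^ \<nu> * det (mat_of ?n ?K) = hafnian ?K {0..<?n} ^ 2 + 4 * r" by (simp add:
      algebra_simps)
  have "(-1) ^ Suc \<nu> * det (mat_of (2 * Suc \<nu>) H) =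
      (H 0 1 ^ 2 - 4 * (x * y)) * ((-1) ^ \<nu> * det (mat_of ?n ?K))"
    unfolding det by (simp add: algebra_simps)
  also have "\<dots> - hafnian H {0..<2 * Suc \<nu>} ^ 2 =
      4 * (H 0 1 ^ 2 * r - x * y * (hafnian ?K {0..<?n} ^ 2 + 4 * r))"
    unfolding haf r by (simp add: algebra_simps power_mult_distrib)
  finally show ?thesis unfolding hafnian_cong_4_def by (rule dvdI)
qed

text \<open>Since \<open>b = G 0 1\<close> is odd, so is the determinant \<open>d = 4 x y - b\<^sup>2\<close> of the plane spanned
  by the first two basis vectors. Replacing every other basis vector \<open>e\<^sub>j\<close> by
  \<open>d e\<^sub>j + s\<^sub>j e\<^sub>0 + t\<^sub>j e\<^sub>1\<close>, with coefficients given by Cramer's rule, makes it orthogonal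
  to this plane without any division.\<close>

lemma hafnian_cong_4_eliminate:
  fixes G :: "nat \<Rightarrow> nat \<Rightarrow> 'a::idom"
  assumes two: "prime_elem (2 :: 'a)"
    and sym: "symmetric G" and diag: "\<And>i. 2 dvd G i i" and odd: "\<not> 2 dvd G 0 1"
    and IH: "\<And>H :: nat \<Rightarrow> nat \<Rightarrow> 'a. symmetric H \<Longrightarrow> (\<And>i. 2 dvd H i i) \<Longrightarrow> hafnian_cong_4 \<nu> H"
  shows "hafnian_cong_4 (Suc \<nu>) G"
proof -
  obtain x y where x: "G 0 0 = 2 * x" and y: "G 1 1 = 2 * y" using diag by (meson dvdE)
  let ?n = "2 * Suc \<nu>"
  let ?b = "G 0 1"
  define d where "d = 4 * (x * y) - ?b ^ 2"
  define s where "s j = ?b * G 1 j - 2 * y * G 0 j" for j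
  define t where "t j = ?b * G 0 j - 2 * x * G 1 j" for j
  \<comment> \<open>Row index \<open>a\<close>, column index \<open>j\<close>: column \<open>j\<close> holds the coordinates of the new basis vector.\<close>
  define U where "U a j = (if j < 2 then if a = j then 1 else 0
    else if a = 0 then s j else if a = 1 then t j else if a = j then d else 0)" for a j
  define H where "H = base_change ?n U G"
  have G10: "G 1 0 = ?b" using symmetricD[OF sym] .
  have col: "(\<Sum>b<?n. G k b * U b j) = G k 0 * s j + (G k 1 * t j + G k j * d)"
    if j: "2 \<le> j" "j < ?n" for k j
  proof -
    have "(\<Sum>b<?n. G k b * U b j) = (\<Sum>b\<in>{0, 1, j}. G k b * U b j)"
      by (rule sum.mono_neutral_right) (use j in \<open>auto simp: U_def\<close>)
    also have "\<dots> = G k 0 * s j + (G k 1 * t j + G k j * d)"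
      using j by (simp add: U_def)
    finally show ?thesis .
  qed
  have perp: "H 0 j = 0 \<and> H 1 j = 0" if j: "2 \<le> j" "j < ?n" for j
  proof
    have "H 0 j = (\<Sum>b<?n. G 0 b * U b j)"
      unfolding H_def by (rule base_change_unit_col) (simp_all add: U_def)
    also have "\<dots> = 0"
      unfolding col[OF j] x s_def t_def d_def by (simp add: algebra_simps power2_eq_square)
    finally show "H 0 j = 0" .
    have "H 1 j = (\<Sum>b<?n. G 1 b * U b j)"
      unfolding H_def by (rule base_change_unit_col) (simp_all add: U_def)
    also have "\<dots> = 0"
      unfolding col[OF j] G10 y s_def t_def d_def by (simp add: algebra_simps power2_eq_square)
    finally show "H 1 j = 0" .
  qed
  have symH: "symmetric H" and diagH: "2 dvd H i i" for i
    unfolding H_def by (rule symmetric_base_change[OF sym], rule even_diag_base_change[OF sym diag])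
  have "H 0 0 = 2 * x" "H 1 1 = 2 * y"
    unfolding H_def x[symmetric] y[symmetric] by (rule base_change_unit_cols; simp add: U_def)+
  then have "hafnian_cong_4 (Suc \<nu>) H"
    by (rule hafnian_cong_4_split_plane[OF symH])
      (use perp symH diagH in \<open>auto intro!: IH simp: symmetric_def\<close>)
  moreover have "\<not> 2 dvd det (mat_of ?n U)"
  proof -
    have dodd: "\<not> 2 dvd d"
    proof
      assume "2 dvd d"
      moreover have "2 dvd 4 * (x * y)" by (rule dvdI[of _ _ "2 * (x * y)"]) simp
      ultimately have "2 dvd ?b * ?b"
        unfolding d_def power2_eq_square by (metis dvd_diff diff_diff_eq2 add_diff_cancel_left')
      then show False using prime_elem_dvd_multD[OF two] odd by blast
    qed
    have one: "\<not> 2 dvd (1 :: 'a)" by (rule prime_elem_not_unit[OF two])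
    have diag_odd: "\<not> 2 dvd U i i" for i using dodd one by (simp add: U_def)
    have "upper_triangular (mat_of ?n U)" by (auto simp: upper_triangular_def U_def)
    then have "det (mat_of ?n U) = (\<Prod>i = 0..<?n. U i i)"
      using det_upper_triangular[of "mat_of ?n U" ?n] by (simp add: prod_list_diag_prod)
    moreover have "\<not> 2 dvd (\<Prod>i\<in>A. U i i)" if "finite A" for A
      using that by (induction A rule: finite_induct) (use one prime_elem_dvd_multD[OF two]
          diag_odd in auto)
    ultimately show ?thesis by (metis finite_atLeastLessThan)
  qed
  ultimately show ?thesis
    unfolding H_def using hafnian_cong_4_of_base_change[OF two sym diag] by blast
qed

text \<open>Either all entries are even, and then \<open>det G\<close> and \<open>haf(G)\<^sup>2\<close> are both divisible by 4,
  or an odd off-diagonal entry can be moved to position \<open>(0, 1)\<close> and a plane splits off.\<close>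

lemma hafnian_cong_4_even_symmetric:
  fixes G :: "nat \<Rightarrow> nat \<Rightarrow> 'a::idom"
  assumes two: "prime_elem (2 :: 'a)"
    and "symmetric G" and "\<And>i. 2 dvd G i i"
  shows "hafnian_cong_4 \<nu> G"
  using assms(2,3)
proof (induction \<nu> arbitrary: G)
  case 0
  then show ?case by (simp add: hafnian_cong_4_def)
next
  case (Suc \<nu>)
  let ?n = "2 * Suc \<nu>"
  show ?case
  proof (cases "\<forall>i<?n. \<forall>j<?n. 2 dvd G i j")
    case True
    define K where "K i j = (SOME q. G i j = 2 * q)" for i j
    have K: "G i j = 2 * K i j" if "i < ?n" "j < ?n" for i j
      unfolding K_def by (rule someI_ex) (use True that in \<open>auto elim!: dvdE\<close>)
    have "mat_of ?n G = 2 \<cdot>\<^sub>m mat_of ?n K" by (rule eq_matI) (simp_all add: K)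
    then have "det (mat_of ?n G) = 4 * (2 ^ (2 * \<nu>) * det (mat_of ?n K))" by simp
    then have "4 dvd det (mat_of ?n G)" by (rule dvdI)
    moreover have "2 dvd hafnian G {0..<?n}"
      using True by (intro hafnian_even_if_even) auto
    then have "4 dvd hafnian G {0..<?n} ^ 2" using cong_4_of_cong_2[of "hafnian G {0..<?n}" 0] by
        simp
    ultimately show ?thesis unfolding hafnian_cong_4_def by (intro dvd_diff dvd_mult)
  next
    case False
    then obtain a b where ab: "a < ?n" "b < ?n" "\<not> 2 dvd G a b" by auto
    then have "a \<noteq> b" using Suc.prems(2) by auto
    define c where "c = Transposition.transpose 0 a b"
    \<comment> \<open>A permutation with \<open>p 0 = a\<close> and \<open>p 1 = b\<close>; the detour through \<open>c\<close> covers overlaps of \<open>a,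
        b\<close> with \<open>0, 1\<close>.\<close>
    define p where "p = Transposition.transpose 0 a \<circ> Transposition.transpose 1 c"
    have c: "c \<noteq> 0" "c < ?n"
      unfolding c_def Transposition.transpose_def using ab(1,2) \<open>a \<noteq> b\<close> by auto
    have p: "p permutes {0..<?n}"
      unfolding p_def using ab c by (intro permutes_compose permutes_swap_id) auto
    have "Transposition.transpose 1 c 0 = 0" using c(1) by (simp add: Transposition.transpose_def)
    then have p01: "p 0 = a" "p 1 = b" by (simp_all add: p_def) (simp add: c_def)
    have "hafnian_cong_4 (Suc \<nu>) (\<lambda>i j. G (p i) (p j))"
      by (rule hafnian_cong_4_eliminate[OF two])
        (use Suc.prems ab(3) p01 Suc.IH in \<open>auto simp: symmetric_def\<close>)
    then show ?thesis using hafnian_cong_4_permute[OF two Suc.prems p] by blast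
  qed
qed

section \<open>The pairing sum as a hafnian\<close>

text \<open>The admissible permutations list each perfect matching once: every edge is written in
  increasing order and the edges are sorted by their smaller ends.\<close>

definition pairing_matching :: "nat \<Rightarrow> (nat \<Rightarrow> nat) \<Rightarrow> nat set set" where
  "pairing_matching \<nu> p = (\<lambda>r. {p (2 * r), p (2 * r + 1)}) ` {..<\<nu>}"

lemma pairing_permsD:
  assumes "p \<in> pairing_perms \<nu>"
  shows "p permutes {0..<2 * \<nu>}" "\<And>r. r < \<nu> \<Longrightarrow> p (2 * r) < p (2 * r + 1)"
    "\<And>r s. r < s \<Longrightarrow> s < \<nu> \<Longrightarrow> p (2 * r) < p (2 * s)"
proof -
  show "p permutes {0..<2 * \<nu>}" "\<And>r. r < \<nu> \<Longrightarrow> p (2 * r) < p (2 * r + 1)"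
    using assms by (auto simp: pairing_perms_def)
  show "p (2 * r) < p (2 * s)" if "r < s" "s < \<nu>" for r s
    using that
  proof (induction s)
    case (Suc s)
    have step: "p (2 * s) < p (2 * (s + 1))" using assms Suc.prems by (simp add: pairing_perms_def)
    show ?case
    proof (cases "r = s")
      case False
      then have "p (2 * r) < p (2 * s)" using Suc by simp
      then show ?thesis using step by simp
    qed (use step in simp)
  qed simp
qed

lemma index_in_pair:
  fixes i \<nu> :: nat
  assumes "i < 2 * \<nu>"
  obtains k where "k < \<nu>" "i = 2 * k \<or> i = 2 * k + 1"
proof (rule that[of "i div 2"])
  show "i div 2 < \<nu>" using assms by linarith
  show "i = 2 * (i div 2) \<or> i = 2 * (i div 2) + 1" by linarith
qed

lemma weight_pairing_matching:
  assumes p: "p \<in> pairing_perms \<nu>"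
  shows "(\<Prod>e\<in>pairing_matching \<nu> p. G (Min e) (Max e)) = (\<Prod>r<\<nu>. G (p (2 * r)) (p (2 * r + 1)))"
proof -
  note p_less = pairing_permsD(2)[OF p]
  have "inj_on (\<lambda>r. {p (2 * r), p (2 * r + 1)}) {..<\<nu>}"
  proof (rule inj_onI)
    fix r s assume rs: "r \<in> {..<\<nu>}" "s \<in> {..<\<nu>}" and eq: "{p (2 * r), p (2 * r + 1)} = {p (2 * s),
        p (2 * s + 1)}"
    have "Min {p (2 * r), p (2 * r + 1)} = p (2 * r)" "Min {p (2 * s), p (2 * s + 1)} = p (2 * s)"
      using p_less[of r] p_less[of s] rs by simp_all
    then have "p (2 * r) = p (2 * s)" unfolding eq by simp
    then show "r = s" using permutes_inj[OF pairing_permsD(1)[OF p]] by (simp add: inj_eq)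
  qed
  then show ?thesis
    unfolding pairing_matching_def using p_less by (simp add: prod.reindex)
qed

lemma pairing_matching_in:
  assumes p: "p \<in> pairing_perms \<nu>"
  shows "pairing_matching \<nu> p \<in> perfect_matchings {0..<2 * \<nu>}"
proof -
  note perm = pairing_permsD(1)[OF p]
  have inj: "p i = p j \<longleftrightarrow> i = j" for i j using permutes_inj[OF perm] by (simp add: inj_eq)
  have "\<Union>(pairing_matching \<nu> p) = p ` {0..<2 * \<nu>}"
  proof
    show "p ` {0..<2 * \<nu>} \<subseteq> \<Union>(pairing_matching \<nu> p)"
    proof
      fix x assume "x \<in> p ` {0..<2 * \<nu>}"
      then obtain i where i: "x = p i" "i < 2 * \<nu>" by auto
      obtain k where k: "k < \<nu>" "i = 2 * k \<or> i = 2 * k + 1" using i(2) by (rule index_in_pair)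
      then have "x \<in> {p (2 * k), p (2 * k + 1)}" using i(1) by blast
      moreover have "{p (2 * k), p (2 * k + 1)} \<in> pairing_matching \<nu> p"
        unfolding pairing_matching_def using k(1) by blast
      ultimately show "x \<in> \<Union>(pairing_matching \<nu> p)" by blast
    qed
  next
    show "\<Union>(pairing_matching \<nu> p) \<subseteq> p ` {0..<2 * \<nu>}"
      unfolding pairing_matching_def by (intro Union_least) auto
  qed
  then have "\<Union>(pairing_matching \<nu> p) = {0..<2 * \<nu>}" using permutes_image[OF perm] by simp
  moreover have "disjoint (pairing_matching \<nu> p)"
    unfolding disjoint_def
  proof (intro ballI impI)
    fix d e assume de: "d \<in> pairing_matching \<nu> p" "e \<in> pairing_matching \<nu> p" "d \<noteq> e"
    obtain r where r: "d = {p (2 * r), p (2 * r + 1)}" using de(1) unfolding pairing_matching_def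
        by blast
    obtain s where s: "e = {p (2 * s), p (2 * s + 1)}" using de(2) unfolding pairing_matching_def
        by blast
    have "r \<noteq> s" using de(3) r s by blast
    then have "2 * r \<noteq> 2 * s" "2 * r \<noteq> 2 * s + 1" "2 * r + 1 \<noteq> 2 * s" "2 * r + 1 \<noteq> 2 * s + 1"
      by presburger+
    then show "d \<inter> e = {}" unfolding r s by (simp only: Int_insert_left Int_empty_left insert_iff
        inj empty_iff simp_thms if_False)
  qed
  moreover have "\<forall>e\<in>pairing_matching \<nu> p. card e = 2"
  proof
    fix e assume "e \<in> pairing_matching \<nu> p"
    then obtain r where r: "e = {p (2 * r), p (2 * r + 1)}" unfolding pairing_matching_def by blast
    have "p (2 * r) \<noteq> p (2 * r + 1)" unfolding inj by presburger
    then show "card e = 2" unfolding r by (simp only: card_2_iff) blast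
  qed
  ultimately show ?thesis by (simp add: perfect_matchings_def)
qed

text \<open>The values at even positions are the sorted list of the minima of the edges, hence
  determined by the matching; each value at an odd position is the partner of its
  predecessor.\<close>

lemma inj_on_pairing_matching: "inj_on (pairing_matching \<nu>) (pairing_perms \<nu>)"
proof (rule inj_onI)
  fix p q assume p: "p \<in> pairing_perms \<nu>" and q: "q \<in> pairing_perms \<nu>"
    and eq: "pairing_matching \<nu> p = pairing_matching \<nu> q"
  have mins: "Min ` pairing_matching \<nu> f = set (map (\<lambda>r. f (2 * r)) [0..<\<nu>])"
    and sorted: "sorted (map (\<lambda>r. f (2 * r)) [0..<\<nu>])"
    and distinct: "distinct (map (\<lambda>r. f (2 * r)) [0..<\<nu>])"
    if f: "f \<in> pairing_perms \<nu>" for f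
  proof -
    show "Min ` pairing_matching \<nu> f = set (map (\<lambda>r. f (2 * r)) [0..<\<nu>])"
      unfolding pairing_matching_def image_image set_map
    proof (rule image_cong)
      show "{..<\<nu>} = set [0..<\<nu>]" by auto
      show "Min {f (2 * r), f (2 * r + 1)} = f (2 * r)" if "r \<in> set [0..<\<nu>]" for r
        using pairing_permsD(2)[OF f, of r] that by simp
    qed
    show "sorted (map (\<lambda>r. f (2 * r)) [0..<\<nu>])"
      unfolding sorted_iff_nth_mono_less
    proof (intro allI impI)
      fix i j assume "i < j" "j < length (map (\<lambda>r. f (2 * r)) [0..<\<nu>])"
      then show "map (\<lambda>r. f (2 * r)) [0..<\<nu>] ! i \<le> map (\<lambda>r. f (2 * r)) [0..<\<nu>] ! j"
        using pairing_permsD(3)[OF f, of i j] by simp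
    qed
    show "distinct (map (\<lambda>r. f (2 * r)) [0..<\<nu>])"
    proof -
      have "inj_on (\<lambda>r. f (2 * r)) (set [0..<\<nu>])"
        using inj_eq[OF permutes_inj[OF pairing_permsD(1)[OF f]]] by (intro inj_onI) simp
      then show ?thesis by (simp only: distinct_map distinct_upt simp_thms)
    qed
  qed
  have "map (\<lambda>r. p (2 * r)) [0..<\<nu>] = map (\<lambda>r. q (2 * r)) [0..<\<nu>]"
    by (rule sorted_distinct_set_unique[OF sorted[OF p] distinct[OF p] sorted[OF q] distinct[OF q]])
      (simp only: mins[OF p, symmetric] mins[OF q, symmetric] eq)
  then have evens: "p (2 * r) = q (2 * r)" if "r < \<nu>" for r using that by (simp add: map_eq_conv)
  have odds: "p (2 * r + 1) = q (2 * r + 1)" if r: "r < \<nu>" for r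
  proof -
    have "{p (2 * r), p (2 * r + 1)} \<in> pairing_matching \<nu> p" "{q (2 * r), q (2 * r + 1)} \<in>
        pairing_matching \<nu> p"
    proof -
      show "{p (2 * r), p (2 * r + 1)} \<in> pairing_matching \<nu> p"
        using r unfolding pairing_matching_def by blast
      show "{q (2 * r), q (2 * r + 1)} \<in> pairing_matching \<nu> p"
        using r unfolding eq unfolding pairing_matching_def by blast
    qed
    then have "{p (2 * r), p (2 * r + 1)} = {q (2 * r), q (2 * r + 1)}"
      by (rule matching_eqI[OF pairing_matching_in[OF p], where x = "p (2 * r)"]) (simp_all add:
          evens[OF r])
    then show ?thesis
      using evens[OF r] pairing_permsD(2)[OF p r] pairing_permsD(2)[OF q r] by (auto simp:
          doubleton_eq_iff)
  qed
  show "p = q"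
  proof
    fix i
    show "p i = q i"
    proof (cases "i < 2 * \<nu>")
      case True
      then obtain k where "k < \<nu>" "i = 2 * k \<or> i = 2 * k + 1" by (rule index_in_pair)
      then show ?thesis using evens[of k] odds[of k] by (elim disjE) simp_all
    next
      case False
      then show ?thesis
        using permutes_not_in[OF pairing_permsD(1)[OF p], of i] permutes_not_in[OF
            pairing_permsD(1)[OF q], of i] by simp
    qed
  qed
qed

lemma card_matching:
  assumes "M \<in> perfect_matchings A" "finite A"
  shows "card A = 2 * card M"
proof -
  have "finite M" using assms(2,1) by (rule finite_matching)
  have "card (\<Union>M) = (\<Sum>e\<in>M. card e)"
    using assms by (intro card_Union_disjoint) (auto simp: perfect_matchings_def pairwise_def
        disjnt_def disjoint_def intro: card_ge_0_finite)
  also have "\<dots> = (\<Sum>e\<in>M. 2)" using assms by (intro sum.cong) (auto simp: perfect_matchings_def)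
  finally show ?thesis using assms by (simp add: perfect_matchings_def)
qed

text \<open>Sort the edges by their minima, which are distinct because edges are disjoint, and
  list their ends.\<close>

lemma pairing_matching_surj:
  assumes M: "M \<in> perfect_matchings {0..<2 * \<nu>}"
  shows "\<exists>p\<in>pairing_perms \<nu>. pairing_matching \<nu> p = M"
proof -
  let ?A = "{0..<2 * \<nu>}"
  have finM: "finite M" by (rule finite_matching[OF _ M]) simp
  have edge: "\<exists>a b. e = {a, b} \<and> a < b \<and> Min e = a \<and> Max e = b \<and> a \<in> ?A \<and> b \<in> ?A" if "e \<in> M" for e
  proof -
    have "card e = 2" "e \<subseteq> ?A" using M that by (auto simp: perfect_matchings_def)
    from this(1) obtain a b where "e = {a, b}" "a < b" "Min e = a" "Max e = b" by (rule edge_cases)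
    with \<open>e \<subseteq> ?A\<close> show ?thesis by blast
  qed
  have injMin: "inj_on Min M"
  proof (rule inj_onI)
    fix e f assume ef: "e \<in> M" "f \<in> M" "Min e = Min f"
    have "Min e \<in> e" "Min f \<in> f" using edge[OF ef(1)] edge[OF ef(2)] by auto
    then show "e = f" using matching_eqI[OF M ef(1,2)] ef(3) by simp
  qed
  define xs where "xs = sorted_list_of_set (Min ` M)"
  have len: "length xs = \<nu>"
    unfolding xs_def using card_matching[OF M] finM injMin by (simp add: card_image)
  have set_xs: "set xs = Min ` M" unfolding xs_def using finM by simp
  have sorted: "sorted_wrt (<) xs" unfolding xs_def by (rule strict_sorted_list_of_set)
  define E where "E r = inv_into M Min (xs ! r)" for r
  have E: "E r \<in> M" "Min (E r) = xs ! r" if "r < \<nu>" for r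
  proof -
    have "xs ! r \<in> Min ` M" using that len set_xs nth_mem by blast
    then show "E r \<in> M" "Min (E r) = xs ! r"
      unfolding E_def by (rule inv_into_into, rule f_inv_into_f)
  qed
  have Esurj: "\<exists>r<\<nu>. E r = e" if "e \<in> M" for e
  proof -
    have "Min e \<in> set xs" using that set_xs by simp
    then obtain r where "r < \<nu>" "xs ! r = Min e" using len by (metis in_set_conv_nth)
    then show ?thesis unfolding E_def using inv_into_f_f[OF injMin that] by auto
  qed
  define p where "p i = (if i < 2 * \<nu> then if even i then Min (E (i div 2)) else Max (E (i div 2))
      else i)" for i
  have p: "p (2 * r) = Min (E r)" "p (2 * r + 1) = Max (E r)" if "r < \<nu>" for r
    using that by (simp_all add: p_def)
  have "p ` ?A = ?A"
  proof
    show "p ` ?A \<subseteq> ?A"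
    proof
      fix x assume "x \<in> p ` ?A"
      then obtain i where i: "i < 2 * \<nu>" "x = p i" by auto
      then have "i div 2 < \<nu>" by auto
      then show "x \<in> ?A" using edge[OF E(1), of "i div 2"] i by (auto simp: p_def)
    qed
    show "?A \<subseteq> p ` ?A"
    proof
      fix x assume "x \<in> ?A"
      then have "x \<in> \<Union>M" using M by (simp add: perfect_matchings_def)
      then obtain e where e: "e \<in> M" "x \<in> e" by blast
      obtain r where r: "r < \<nu>" "E r = e" using Esurj[OF e(1)] by blast
      have "x = Min e \<or> x = Max e" using edge[OF e(1)] e(2) by auto
      then have "x = p (2 * r) \<or> x = p (2 * r + 1)" using p[OF r(1)] r(2) by simp
      moreover have "2 * r \<in> ?A" "2 * r + 1 \<in> ?A" using r(1) by auto
      ultimately show "x \<in> p ` ?A" by blast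
    qed
  qed
  then have "bij_betw p ?A ?A" by (simp add: bij_betw_def finite_surj_inj)
  then have perm: "p permutes ?A" by (rule bij_imp_permutes) (simp add: p_def)
  have "p (2 * r) < p (2 * r + 1)" if "r < \<nu>" for r
    using edge[OF E(1)[OF that]] p[OF that] by auto
  moreover have "p (2 * r) < p (2 * (r + 1))" if "r + 1 < \<nu>" for r
    using p(1)[of r] p(1)[of "r + 1"] E(2)[of r] E(2)[of "r + 1"] that sorted len
    by (simp add: sorted_wrt_iff_nth_less)
  ultimately have "p \<in> pairing_perms \<nu>" using perm by (simp add: pairing_perms_def)
  moreover have "pairing_matching \<nu> p = M"
  proof -
    have "{p (2 * r), p (2 * r + 1)} = E r" if "r < \<nu>" for r
      using edge[OF E(1)[OF that]] p[OF that] by auto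
    then have "pairing_matching \<nu> p = E ` {..<\<nu>}"
      unfolding pairing_matching_def by (intro image_cong) auto
    also have "\<dots> = M" using E(1) Esurj by blast
    finally show ?thesis .
  qed
  ultimately show ?thesis by blast
qed

lemma S_poly_eq_hafnian: "S_poly \<nu> = hafnian (B_poly \<nu>) {0..<2 * \<nu>}"
proof -
  have bij: "bij_betw (pairing_matching \<nu>) (pairing_perms \<nu>) (perfect_matchings {0..<2 * \<nu>})"
    unfolding bij_betw_def using inj_on_pairing_matching pairing_matching_in pairing_matching_surj
        by blast
  have "hafnian (B_poly \<nu>) {0..<2 * \<nu>} =
      (\<Sum>p\<in>pairing_perms \<nu>. \<Prod>e\<in>pairing_matching \<nu> p. B_poly \<nu> (Min e) (Max e))"
    unfolding hafnian_def by (rule sum.reindex_bij_betw[OF bij, symmetric])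
  also have "\<dots> = S_poly \<nu>"
    unfolding S_poly_def by (intro sum.cong refl weight_pairing_matching)
  finally show ?thesis by simp
qed

section \<open>The polynomial Delta and its quadratic equation\<close>

lemma sum_lessThan_double: "(\<Sum>a<2 * \<nu>. f a) = (\<Sum>t<\<nu>. f t) + (\<Sum>t<\<nu>. f (\<nu> + t :: nat) ::
    'a::comm_monoid_add)"
proof -
  have "(\<Sum>a<2 * \<nu>. f a) = (\<Sum>a = 0..<\<nu> + \<nu>. f a)"
    by (simp only: lessThan_atLeast0 mult_2)
  also have "\<dots> = (\<Sum>a = 0..<\<nu>. f a) + (\<Sum>a = \<nu>..<\<nu> + \<nu>. f a)"
    by (rule sum.atLeastLessThan_concat[symmetric]) simp_all
  also have "(\<Sum>a = \<nu>..<\<nu> + \<nu>. f a) = (\<Sum>t = 0..<\<nu>. f (\<nu> + t))"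
    using sum.shift_bounds_nat_ivl[of f 0 \<nu> \<nu>] by (simp only: add_0 add.commute)
  finally show ?thesis by (simp only: lessThan_atLeast0)
qed

lemma base_change_hyperbolic:
  "base_change (2 * \<nu>) U (hyperbolic \<nu>) i j = (\<Sum>t<\<nu>. U t i * U (\<nu> + t) j + U (\<nu> + t) i * U t j)"
proof -
  let ?F = "\<lambda>a b. U a i * hyperbolic \<nu> a b * U b j"
  have 1: "(\<Sum>b<2 * \<nu>. ?F t b) = U t i * U (\<nu> + t) j" if "t < \<nu>" for t
  proof -
    have "(\<Sum>b<2 * \<nu>. ?F t b) = (\<Sum>b<2 * \<nu>. if b = \<nu> + t then U t i * U b j else 0)"
      by (rule sum.cong) (use that in \<open>auto simp: hyperbolic_def\<close>)
    then show ?thesis using that by simp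
  qed
  have 2: "(\<Sum>b<2 * \<nu>. ?F (\<nu> + t) b) = U (\<nu> + t) i * U t j" if "t < \<nu>" for t
  proof -
    have "(\<Sum>b<2 * \<nu>. ?F (\<nu> + t) b) = (\<Sum>b<2 * \<nu>. if b = t then U (\<nu> + t) i * U b j else 0)"
      by (rule sum.cong) (use that in \<open>auto simp: hyperbolic_def\<close>)
    then show ?thesis using that by simp
  qed
  have "base_change (2 * \<nu>) U (hyperbolic \<nu>) i j = (\<Sum>t<\<nu>. \<Sum>b<2 * \<nu>. ?F t b) + (\<Sum>t<\<nu>. \<Sum>b<2 * \<nu>. ?F
      (\<nu> + t) b)"
    unfolding base_change_def by (rule sum_lessThan_double)
  then show ?thesis by (simp add: 1 2 sum.distrib)
qed

lemma hyperbolic_diag: "hyperbolic \<nu> i i = 0"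
  by (simp add: hyperbolic_def)

lemma B_poly_eq_base_change: "B_poly \<nu> i j = base_change (2 * \<nu>) (\<lambda>s i. Var (s, i)) (hyperbolic \<nu>)
    i j"
  by (simp add: base_change_hyperbolic B_poly_def)

lemma D_poly_eq: "D_poly \<nu> = det (mat_of (2 * \<nu>) (\<lambda>s i. Var (s, i)))"
  by (simp add: D_poly_def)

lemma two_neq_0_mpoly: "(2 :: (nat \<times> nat, int) mpoly) \<noteq> 0"
  by simp

text \<open>The Gram matrix is a base change of the hyperbolic one by the matrix of all vectors.
  The hafnian of the latter is 1, so \<open>S \<equiv> D\<close> modulo 2, and the quotient by 2 is unique
  because the ring has no zero divisors.\<close>

lemma Delta_int_eq: "2 * Delta_int \<nu> = S_poly \<nu> - D_poly \<nu>"
proof -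
  have "2 dvd S_poly \<nu> - D_poly \<nu>"
    using hafnian_base_change_mod_2[OF symmetric_hyperbolic, of \<nu> "2 * \<nu>" "\<lambda>s i. Var (s, i)"]
    by (simp add: hyperbolic_diag S_poly_eq_hafnian D_poly_eq B_poly_eq_base_change[abs_def]
        hafnian_hyperbolic)
  then obtain d where d: "2 * d = S_poly \<nu> - D_poly \<nu>" by (metis dvdE)
  moreover have "e = d" if "2 * e = S_poly \<nu> - D_poly \<nu>" for e
    using that d mult_left_cancel[OF two_neq_0_mpoly] by metis
  ultimately show ?thesis
    unfolding Delta_int_def by (rule theI[where P = "\<lambda>d. 2 * d = S_poly \<nu> - D_poly \<nu>"])
qed

text \<open>Its square is 1 since exchanging \<open>x\<^sub>t\<close> and \<open>y\<^sub>t\<close> for all \<open>t\<close> preserves the form, and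
  the congruence modulo 4 selects the sign.\<close>

lemma det_hyperbolic: "det (mat_of (2 * \<nu>) (hyperbolic \<nu> :: _ \<Rightarrow> _ \<Rightarrow> int)) = (-1) ^ \<nu>"
proof -
  let ?J = "hyperbolic \<nu> :: nat \<Rightarrow> nat \<Rightarrow> int"
  \<comment> \<open>The matrix is itself a permutation matrix, so it can serve as the change of basis.\<close>
  define f where "f i = (if i < \<nu> then \<nu> + i else i - \<nu>)" for i
  have "base_change (2 * \<nu>) ?J ?J i j = ?J i j" if "i < 2 * \<nu>" "j < 2 * \<nu>" for i j
  proof -
    have "base_change (2 * \<nu>) ?J ?J i j = ?J (f i) (f j)"
      by (rule base_change_unit_cols) (use that in \<open>auto simp: hyperbolic_def f_def\<close>)
    also have "\<dots> = ?J i j" using that by (auto simp: hyperbolic_def f_def)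
    finally show ?thesis .
  qed
  then have "mat_of (2 * \<nu>) (base_change (2 * \<nu>) ?J ?J) = mat_of (2 * \<nu>) ?J" by (intro eq_matI)
      simp_all
  then have sq: "det (mat_of (2 * \<nu>) ?J) ^ 2 * det (mat_of (2 * \<nu>) ?J) = det (mat_of (2 * \<nu>) ?J)"
    by (metis det_base_change)
  have "prime_elem (2 :: int)" by (rule prime_imp_prime_elem) simp
  then have "hafnian_cong_4 \<nu> ?J"
    by (rule hafnian_cong_4_even_symmetric) (simp_all add: symmetric_hyperbolic hyperbolic_diag)
  then have 4: "4 dvd (-1) ^ \<nu> * det (mat_of (2 * \<nu>) ?J) - 1"
    by (simp add: hafnian_cong_4_def hafnian_hyperbolic)
  then have "det (mat_of (2 * \<nu>) ?J) \<noteq> 0" by auto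
  then have "det (mat_of (2 * \<nu>) ?J) ^ 2 = 1" using sq by simp
  then have "det (mat_of (2 * \<nu>) ?J) = 1 \<or> det (mat_of (2 * \<nu>) ?J) = -1" by (simp add:
      power2_eq_1_iff)
  then show ?thesis using 4 by (cases "even \<nu>") auto
qed

lemma D_poly_squared: "D_poly \<nu> ^ 2 = (-1) ^ \<nu> * det (mat_of (2 * \<nu>) (B_poly \<nu>))"
proof -
  interpret comm_ring_hom "of_int :: int \<Rightarrow> (nat \<times> nat, int) mpoly" by (rule
      of_int_hom.comm_ring_hom_axioms)
  have "mat_of (2 * \<nu>) (hyperbolic \<nu>) = map_mat (of_int :: int \<Rightarrow> (nat \<times> nat, int) mpoly) (mat_of
      (2 * \<nu>) (hyperbolic \<nu>))"
    by (rule eq_matI) (simp_all add: hyperbolic_def)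
  then have J: "det (mat_of (2 * \<nu>) (hyperbolic \<nu>)) = ((-1) ^ \<nu> :: (nat \<times> nat, int) mpoly)"
    by (simp add: det_hyperbolic)
  have "mat_of (2 * \<nu>) (B_poly \<nu>) = mat_of (2 * \<nu>) (base_change (2 * \<nu>) (\<lambda>s i. Var (s, i))
      (hyperbolic \<nu>))"
    by (simp add: B_poly_eq_base_change)
  then have "det (mat_of (2 * \<nu>) (B_poly \<nu>)) = D_poly \<nu> ^ 2 * (-1) ^ \<nu>"
    by (simp add: det_base_change D_poly_eq J)
  moreover have "(-1) ^ \<nu> * (-1) ^ \<nu> = (1 :: (nat \<times> nat, int) mpoly)"
    by (simp only: power_mult_distrib[symmetric]) simp
  ultimately have "(-1) ^ \<nu> * det (mat_of (2 * \<nu>) (B_poly \<nu>)) = D_poly \<nu> ^ 2 * 1"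
    by (simp only: mult.assoc mult.left_commute[of "(-1) ^ \<nu>"])
  then show ?thesis by simp
qed

definition Q_poly :: "nat \<Rightarrow> nat \<Rightarrow> (nat \<times> nat, int) mpoly" where
  "Q_poly \<nu> i = (\<Sum>t<\<nu>. Var (t, i) * Var (\<nu> + t, i))"

text \<open>The generic symmetric matrix with even diagonal: the variable \<open>(i, i)\<close> stands for
  \<open>q(v\<^sub>i)\<close> and, for \<open>i < j\<close>, the variable \<open>(i, j)\<close> stands for \<open>B\<^sub>i\<^sub>j\<close>.\<close>

definition generic_gram :: "nat \<Rightarrow> nat \<Rightarrow> (nat \<times> nat, int) mpoly" where
  "generic_gram i j = (if i = j then 2 * Var (i, i) else Var (min i j, max i j))"

definition substitute_gram :: "nat \<Rightarrow> (nat \<times> nat, int) mpoly \<Rightarrow> (nat \<times> nat, int) mpoly" where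
  "substitute_gram \<nu> = eval_with of_int (\<lambda>(i, j). if i = j then Q_poly \<nu> i else B_poly \<nu> i j)"

text \<open>The roots \<open>\<Delta>\<close> and \<open>- (\<Delta> + D)\<close> of the quadratic equation have product \<open>- \<Delta> (\<Delta> + D)\<close>.
  The division by 4 takes place in the ring of generic Gram entries; only afterwards are
  \<open>q(v\<^sub>i)\<close> and \<open>B\<^sub>i\<^sub>j\<close> substituted.\<close>

lemma norm_Delta_in_gram:
  assumes char2: "CHAR('k::field) = 2"
  shows "\<exists>P. substitute_gram \<nu> P = Delta_int \<nu> * (Delta_int \<nu> + D_poly \<nu>)"
proof -
  let ?G = "generic_gram"
  have "hafnian_cong_4 \<nu> ?G"
    by (rule hafnian_cong_4_even_symmetric[OF prime_elem_2_int_mpoly[OF char2]])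
      (auto simp: symmetric_def generic_gram_def min.commute max.commute)
  then obtain P where P: "(-1) ^ \<nu> * det (mat_of (2 * \<nu>) ?G) - hafnian ?G {0..<2 * \<nu>} ^ 2 = 4 * P"
    unfolding hafnian_cong_4_def ..
  have hom: "comm_ring_hom (substitute_gram \<nu>)"
    unfolding substitute_gram_def by (rule comm_ring_hom.comm_ring_hom_eval_with[OF
        of_int_hom.comm_ring_hom_axioms])
  interpret comm_ring_hom "substitute_gram \<nu>" by (rule hom)
  have B_diag: "B_poly \<nu> i i = 2 * Q_poly \<nu> i" for i
    by (simp add: B_poly_def Q_poly_def mult.commute sum_distrib_left)
  have Bsym: "B_poly \<nu> i j = B_poly \<nu> j i" for i j
    by (simp add: B_poly_def mult.commute add.commute)
  have gram: "substitute_gram \<nu> (?G i j) = B_poly \<nu> i j" for i j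
  proof (cases "i = j")
    case True
    have "substitute_gram \<nu> (2 * Var (i, i)) = 2 * substitute_gram \<nu> (Var (i, i))"
      by (simp only: mult_2 hom_add)
    then show ?thesis using True
      by (simp add: generic_gram_def B_diag substitute_gram_def eval_with_Var[OF
          of_int_hom.comm_ring_hom_axioms])
  next
    case False
    then have "min i j \<noteq> max i j" by (simp add: min_def max_def)
    then have "substitute_gram \<nu> (?G i j) = B_poly \<nu> (min i j) (max i j)"
      using False by (simp add: generic_gram_def substitute_gram_def eval_with_Var[OF
          of_int_hom.comm_ring_hom_axioms])
    then show ?thesis using Bsym[of i j] by (simp add: min_def max_def split: if_splits)
  qed
  have "map_mat (substitute_gram \<nu>) (mat_of (2 * \<nu>) ?G) = mat_of (2 * \<nu>) (B_poly \<nu>)"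
    by (rule eq_matI) (simp_all add: gram)
  then have det: "substitute_gram \<nu> (det (mat_of (2 * \<nu>) ?G)) = det (mat_of (2 * \<nu>) (B_poly \<nu>))"
    using hom_det[of "mat_of (2 * \<nu>) ?G"] by (simp only:)
  have haf: "substitute_gram \<nu> (hafnian ?G {0..<2 * \<nu>}) = S_poly \<nu>"
    by (simp add: hom_hafnian[OF hom] gram S_poly_eq_hafnian)
  have "D_poly \<nu> ^ 2 - S_poly \<nu> ^ 2 = substitute_gram \<nu> (4 * P)"
    unfolding P[symmetric] hom_minus hom_mult hom_power det haf D_poly_squared hom_uminus hom_one ..
  also have "\<dots> = 4 * substitute_gram \<nu> P" by (simp only: hom_mult hom_numeral)
  finally have "4 * substitute_gram \<nu> P = D_poly \<nu> ^ 2 - S_poly \<nu> ^ 2" by simp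
  also have "S_poly \<nu> = 2 * Delta_int \<nu> + D_poly \<nu>" by (simp add: Delta_int_eq)
  also have "D_poly \<nu> ^ 2 - (2 * Delta_int \<nu> + D_poly \<nu>) ^ 2 = 4 * (- (Delta_int \<nu> * (Delta_int \<nu>
      + D_poly \<nu>)))"
    by (simp add: power2_eq_square algebra_simps)
  finally have "substitute_gram \<nu> P = - (Delta_int \<nu> * (Delta_int \<nu> + D_poly \<nu>))"
    by simp
  then have "substitute_gram \<nu> (- P) = Delta_int \<nu> * (Delta_int \<nu> + D_poly \<nu>)" by (simp add:
      hom_uminus)
  then show ?thesis ..
qed

lemma polys_in_D_poly: "D_poly \<nu> \<in> polys_in ({0..<2 * \<nu>} \<times> {0..<2 * \<nu>})"
proof -
  let ?X = "{0..<2 * \<nu>} \<times> {0..<2 * \<nu>}"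
  have "(of_int (sign p) * (\<Prod>i = 0..<2 * \<nu>. mat (2 * \<nu>) (2 * \<nu>) Var $$ (i, p i)) :: (nat \<times> nat,
      int) mpoly)
    \<in> polys_in ?X" if p: "p permutes {0..<2 * \<nu>}" for p
  proof (rule polys_in_mult)
    show "(of_int (sign p) :: (nat \<times> nat, int) mpoly) \<in> polys_in ?X"
      using polys_in_1[of ?X, where 'a = int] polys_in_diff[OF polys_in_0 polys_in_1, of ?X, where
          'a = int]
      by (cases p rule: sign_cases) simp_all
    have "p i < 2 * \<nu>" if "i < 2 * \<nu>" for i using permutes_in_image[OF p, of i] that by simp
    then show "(\<Prod>i = 0..<2 * \<nu>. mat (2 * \<nu>) (2 * \<nu>) Var $$ (i, p i) :: (nat \<times> nat, int) mpoly) \<in>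
        polys_in ?X"
      by (intro polys_in_prod) (simp add: polys_in_Var)
  qed
  then show ?thesis
    unfolding D_poly_def det_def'[OF mat_carrier] by (intro polys_in_sum) simp
qed

lemma polys_in_S_poly: "S_poly \<nu> \<in> polys_in ({0..<2 * \<nu>} \<times> {0..<2 * \<nu>})"
proof -
  let ?X = "{0..<2 * \<nu>} \<times> {0..<2 * \<nu>}"
  have "B_poly \<nu> i j \<in> polys_in ?X" if "i < 2 * \<nu>" "j < 2 * \<nu>" for i j
    unfolding B_poly_def using that
    by (intro polys_in_sum polys_in_add polys_in_mult polys_in_Var) auto
  moreover have "p i < 2 * \<nu>" if "p \<in> pairing_perms \<nu>" "i < 2 * \<nu>" for p i
    using permutes_in_image[OF pairing_permsD(1)[OF that(1)], of i] that(2) by simp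
  ultimately show ?thesis
    unfolding S_poly_def by (intro polys_in_sum polys_in_prod) simp
qed

lemma Delta_int_in: "Delta_int \<nu> \<in> polys_in ({0..<2 * \<nu>} \<times> {0..<2 * \<nu>})"
proof -
  have "2 * Delta_int \<nu> \<in> polys_in ({0..<2 * \<nu>} \<times> {0..<2 * \<nu>})"
    unfolding Delta_int_eq by (rule polys_in_diff[OF polys_in_S_poly polys_in_D_poly])
  moreover have "Poly_Mapping.keys (2 * Delta_int \<nu>) = Poly_Mapping.keys (Delta_int \<nu>)"
    by (simp add: set_eq_iff in_keys_iff lookup_two_times)
  ultimately show ?thesis by (simp add: polys_in_def)
qed

lemma Delta_in_R_alg: "(Delta \<nu> :: (nat \<times> nat, 'k::field) mpoly) \<in> R_alg \<nu>"
proof -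
  have "Poly_Mapping.lookup (Delta \<nu> :: (nat \<times> nat, 'k) mpoly) m = of_int (Poly_Mapping.lookup
      (Delta_int \<nu>) m)" for m
    unfolding Delta_def by (simp add: map.rep_eq when_def)
  then have "Poly_Mapping.keys (Delta \<nu> :: (nat \<times> nat, 'k) mpoly) \<subseteq> Poly_Mapping.keys (Delta_int \<nu>)"
    by (intro subsetI) (simp add: in_keys_iff, metis of_int_0)
  then show ?thesis using Delta_int_in[of \<nu>] unfolding R_alg_def polys_in_def by blast
qed

section \<open>Orthogonal substitutions and the two roots\<close>

definition reduce :: "(nat \<times> nat, int) mpoly \<Rightarrow> (nat \<times> nat, 'k::field) mpoly" where
  "reduce = Poly_Mapping.map of_int"

lemma reduce_eq: "reduce = eval_with (Const \<circ> of_int) Var"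
  unfolding reduce_def by (rule map_eq_eval_with[OF of_int_hom.comm_ring_hom_axioms])

lemma comm_ring_hom_reduce: "comm_ring_hom reduce"
  unfolding reduce_eq
  by (intro comm_ring_hom.comm_ring_hom_eval_with comm_ring_hom_comp comm_ring_hom_Const
      of_int_hom.comm_ring_hom_axioms)

lemma reduce_Var: "reduce (Var x) = Var x"
  unfolding reduce_eq by (rule eval_with_Var) (intro comm_ring_hom_comp comm_ring_hom_Const
      of_int_hom.comm_ring_hom_axioms)

lemma Delta_eq_reduce: "Delta \<nu> = reduce (Delta_int \<nu>)"
  by (simp add: Delta_def reduce_def)

lemma two_eq_0_mpoly:
  assumes "CHAR('k::field) = 2" shows "(2 :: ('v, 'k) mpoly) = 0"
proof -
  interpret Const: comm_ring_hom "Const :: 'k \<Rightarrow> ('v, 'k) mpoly" by (rule comm_ring_hom_Const)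
  have "(2 :: 'k) = 0" using of_nat_CHAR[where 'a = 'k] assms by simp
  then have "Const (2 :: 'k) = (0 :: ('v, 'k) mpoly)" by (simp only: Const.hom_zero)
  then show ?thesis by (simp only: Const.hom_numeral)
qed

lemma reduce_S_eq_D:
  assumes "CHAR('k::field) = 2"
  shows "reduce (S_poly \<nu>) = (reduce (D_poly \<nu>) :: (nat \<times> nat, 'k) mpoly)"
proof -
  interpret comm_ring_hom "reduce :: _ \<Rightarrow> (nat \<times> nat, 'k) mpoly" by (rule comm_ring_hom_reduce)
  have "reduce (S_poly \<nu>) - reduce (D_poly \<nu>) = (reduce (2 * Delta_int \<nu>) :: (nat \<times> nat, 'k) mpoly)"
    by (simp only: Delta_int_eq hom_minus)
  also have "\<dots> = 0" by (simp only: hom_mult hom_numeral two_eq_0_mpoly[OF assms] mult_zero_left)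
  finally show ?thesis by simp
qed

text \<open>Such an endomorphism fixes \<open>D = S\<close> and \<open>\<Delta> (\<Delta> + D)\<close>, so it maps \<open>\<Delta>\<close> to a root of
  \<open>X (X + D) = \<Delta> (\<Delta> + D)\<close>.\<close>

lemma endomorphism_dichotomy:
  fixes \<psi> :: "(nat \<times> nat, 'k::field) mpoly \<Rightarrow> (nat \<times> nat, 'k) mpoly"
  assumes char2: "CHAR('k) = 2" and hom: "comm_ring_hom \<psi>"
    and Q: "\<And>i. \<psi> (reduce (Q_poly \<nu> i)) = reduce (Q_poly \<nu> i)"
    and B: "\<And>i j. \<psi> (reduce (B_poly \<nu> i j)) = reduce (B_poly \<nu> i j)"
  shows "\<psi> (Delta \<nu>) = Delta \<nu> \<or> \<psi> (Delta \<nu>) = Delta \<nu> + reduce (D_poly \<nu>)"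
proof -
  let ?R = "reduce :: _ \<Rightarrow> (nat \<times> nat, 'k) mpoly"
  let ?X = "\<psi> (Delta \<nu>)" and ?Y = "Delta \<nu> :: (nat \<times> nat, 'k) mpoly" and ?D = "?R (D_poly \<nu>)"
  interpret \<psi>: comm_ring_hom \<psi> by (rule hom)
  interpret R: comm_ring_hom ?R by (rule comm_ring_hom_reduce)
  have D: "\<psi> ?D = ?D"
    unfolding reduce_S_eq_D[OF char2, symmetric] S_poly_eq_hafnian
    by (simp only: hom_hafnian[OF comm_ring_hom_reduce] hom_hafnian[OF hom] B)
  obtain P where P: "substitute_gram \<nu> P = Delta_int \<nu> * (Delta_int \<nu> + D_poly \<nu>)"
    using norm_Delta_in_gram[OF char2] by blast
  let ?s = "\<lambda>(i, j). if i = j then Q_poly \<nu> i else B_poly \<nu> i j"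
  have "\<psi> (?R (substitute_gram \<nu> P)) = eval_with (\<psi> \<circ> (?R \<circ> of_int)) (\<psi> \<circ> (?R \<circ> ?s)) P"
    unfolding substitute_gram_def by (simp only: hom_eval_with[OF comm_ring_hom_reduce]
        hom_eval_with[OF hom])
  also have "\<psi> \<circ> (?R \<circ> of_int) = ?R \<circ> of_int"
    by (simp add: fun_eq_iff R.hom_of_int \<psi>.hom_of_int)
  also have "\<psi> \<circ> (?R \<circ> ?s) = ?R \<circ> ?s"
    by (simp add: fun_eq_iff Q B)
  also have "eval_with (?R \<circ> of_int) (?R \<circ> ?s) P = ?R (substitute_gram \<nu> P)"
    unfolding substitute_gram_def by (simp only: hom_eval_with[OF comm_ring_hom_reduce])
  finally have "\<psi> (?R (substitute_gram \<nu> P)) = ?R (substitute_gram \<nu> P)" .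
  then have "?X * (?X + ?D) = ?Y * (?Y + ?D)"
    unfolding P by (simp only: R.hom_mult R.hom_add \<psi>.hom_mult \<psi>.hom_add D Delta_eq_reduce)
  then have "(?X - ?Y) * (?X + ?Y + ?D) = 0"
    by (simp add: algebra_simps)
  then have "?X = ?Y \<or> ?X + ?Y + ?D = 0" by simp
  moreover have "?X = ?Y + ?D" if "?X + ?Y + ?D = 0"
  proof -
    have "?X = (?X + ?Y + ?D) - 2 * (?Y + ?D) + (?Y + ?D)" by (simp add: algebra_simps)
    then show ?thesis unfolding that two_eq_0_mpoly[OF char2] by simp
  qed
  ultimately show ?thesis by blast
qed

text \<open>The quadratic form on coordinate functions over an arbitrary commutative ring, needed
  because the orthogonal matrix acts on vectors whose coordinates are polynomials.\<close>

definition quad_form :: "nat \<Rightarrow> (nat \<Rightarrow> 'a::comm_ring_1) \<Rightarrow> 'a" where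
  "quad_form \<nu> v = (\<Sum>t<\<nu>. v t * v (\<nu> + t))"

definition polar_form :: "nat \<Rightarrow> (nat \<Rightarrow> 'a::comm_ring_1) \<Rightarrow> (nat \<Rightarrow> 'a) \<Rightarrow> 'a" where
  "polar_form \<nu> v w = (\<Sum>t<\<nu>. v t * w (\<nu> + t) + v (\<nu> + t) * w t)"

lemma quad_form_add: "quad_form \<nu> (\<lambda>a. v a + w a) = quad_form \<nu> v + quad_form \<nu> w + polar_form \<nu> v
    w"
  by (simp add: quad_form_def polar_form_def sum.distrib[symmetric] algebra_simps)

lemma quad_form_scale: "quad_form \<nu> (\<lambda>a. v a * c) = quad_form \<nu> v * c ^ 2"
  unfolding quad_form_def sum_distrib_right by (rule sum.cong) (simp_all add: power2_eq_square
      mult_ac)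

lemma polar_form_sum_left: "polar_form \<nu> (\<lambda>a. \<Sum>s\<in>S. v s a) w = (\<Sum>s\<in>S. polar_form \<nu> (v s) w)"
  unfolding polar_form_def by (subst sum.swap) (simp add: sum_distrib_right sum.distrib)

lemma polar_form_scale: "polar_form \<nu> (\<lambda>a. v a * c) (\<lambda>a. w a * d) = polar_form \<nu> v w * (c * d)"
  unfolding polar_form_def sum_distrib_right by (rule sum.cong) (simp_all add: algebra_simps)

lemma quad_form_linear_combination:
  fixes m :: nat
  shows "quad_form \<nu> (\<lambda>a. \<Sum>s<m. c s a * w s) =
    (\<Sum>s<m. quad_form \<nu> (c s) * w s ^ 2 + (\<Sum>r<s. polar_form \<nu> (c r) (c s) * (w r * w s)))"
proof (induction m)
  case 0
  then show ?case by (simp add: quad_form_def)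
next
  case (Suc m)
  have "quad_form \<nu> (\<lambda>a. \<Sum>s<Suc m. c s a * w s) = quad_form \<nu> (\<lambda>a. (\<Sum>s<m. c s a * w s) + c m a * w
      m)"
    by simp
  also have "\<dots> = quad_form \<nu> (\<lambda>a. \<Sum>s<m. c s a * w s) + quad_form \<nu> (c m) * w m ^ 2 +
      (\<Sum>r<m. polar_form \<nu> (c r) (c m) * (w r * w m))"
    by (simp only: quad_form_add quad_form_scale polar_form_sum_left polar_form_scale)
  finally show ?case using Suc.IH by (simp add: add.assoc)
qed

lemma quad_form_cong: "(\<And>a. a < 2 * \<nu> \<Longrightarrow> v a = w a) \<Longrightarrow> quad_form \<nu> v = quad_form \<nu> w"
  unfolding quad_form_def by (rule sum.cong) simp_all

lemma polar_form_eq_quad_form: "polar_form \<nu> v w = quad_form \<nu> (\<lambda>a. v a + w a) - quad_form \<nu> v -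
    quad_form \<nu> w"
  by (simp add: quad_form_add)

text \<open>Invariance of the form on vectors over the smaller ring gives the values of the form
  and of its polarisation on the columns of \<open>g\<close>, by evaluation at basis vectors and at sums
  of two of them. These values determine the form on all linear combinations, whatever ring
  the coefficients lie in.\<close>

lemma quad_form_extend_scalars:
  fixes h :: "'a::comm_ring_1 \<Rightarrow> 'b::comm_ring_1" and g :: "nat \<Rightarrow> nat \<Rightarrow> 'a"
  assumes hom: "comm_ring_hom h"
    and iso: "\<And>v. quad_form \<nu> (\<lambda>a. \<Sum>s<2 * \<nu>. g a s * v s) = quad_form \<nu> v"
  shows "quad_form \<nu> (\<lambda>a. \<Sum>s<2 * \<nu>. h (g a s) * w s) = quad_form \<nu> w"
proof -
  interpret comm_ring_hom h by (rule hom)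
  let ?n = "2 * \<nu>"
  define u where "u s a = (if a = s then 1 else 0 :: 'a)" for s a :: nat
  define c where "c s a = g a s" for s a
  have col: "(\<lambda>a. \<Sum>s'<?n. g a s' * u s s') = c s" if "s < ?n" for s
  proof
    fix a
    have "(\<Sum>s'<?n. g a s' * u s s') = (\<Sum>s'<?n. if s' = s then g a s' else 0)"
      by (rule sum.cong) (simp_all add: u_def)
    then show "(\<Sum>s'<?n. g a s' * u s s') = c s a" using that by (simp add: c_def)
  qed
  have q: "quad_form \<nu> (c s) = quad_form \<nu> (u s)" if "s < ?n" for s
    using iso[of "u s"] by (simp only: col[OF that])
  have b: "polar_form \<nu> (c r) (c s) = polar_form \<nu> (u r) (u s)" if "r < ?n" "s < ?n" for r s
  proof -
    have "(\<lambda>a. \<Sum>s'<?n. g a s' * (u r s' + u s s')) = (\<lambda>a. c r a + c s a)"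
      by (simp only: distrib_left sum.distrib fun_cong[OF col[OF that(1)]] fun_cong[OF col[OF
          that(2)]])
    then have "quad_form \<nu> (\<lambda>a. c r a + c s a) = quad_form \<nu> (\<lambda>a. u r a + u s a)"
      using iso[of "\<lambda>a. u r a + u s a"] by (simp only:)
    then show ?thesis by (simp only: polar_form_eq_quad_form q[OF that(1)] q[OF that(2)])
  qed
  have hq: "h (quad_form \<nu> v) = quad_form \<nu> (\<lambda>a. h (v a))" for v
    by (simp add: quad_form_def hom_sum hom_mult)
  have hb: "h (polar_form \<nu> v v') = polar_form \<nu> (\<lambda>a. h (v a)) (\<lambda>a. h (v' a))" for v v'
    by (simp add: polar_form_def hom_sum hom_mult hom_add)
  have "quad_form \<nu> (\<lambda>a. \<Sum>s<?n. h (c s a) * w s) = quad_form \<nu> (\<lambda>a. \<Sum>s<?n. h (u s a) * w s)"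
    unfolding quad_form_linear_combination[of \<nu> "\<lambda>s a. h (c s a)"] quad_form_linear_combination[of
        \<nu> "\<lambda>s a. h (u s a)"]
    by (intro sum.cong arg_cong2[where f = "(+)"] refl)
      (simp_all add: q b flip: hq hb)
  also have "\<dots> = quad_form \<nu> w"
  proof (rule quad_form_cong)
    fix a assume a: "a < ?n"
    have "(\<Sum>s<?n. h (u s a) * w s) = (\<Sum>s<?n. if s = a then w s else 0)"
      by (rule sum.cong) (simp_all add: u_def)
    then show "(\<Sum>s<?n. h (u s a) * w s) = w a" using a by simp
  qed
  finally show ?thesis by (simp add: c_def)
qed

lemma O_group_quad_form:
  fixes g :: "'k::field mat"
  assumes "g \<in> O_group \<nu>"
  shows "quad_form \<nu> (\<lambda>a. \<Sum>s<2 * \<nu>. g $$ (a, s) * v s) = quad_form \<nu> v"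
proof -
  have g: "g \<in> carrier_mat (2 * \<nu>) (2 * \<nu>)"
    and q: "quad \<nu> (g *\<^sub>v vec (2 * \<nu>) v) = quad \<nu> (vec (2 * \<nu>) v)"
    using assms by (auto simp: O_group_def)
  have entry: "(g *\<^sub>v vec (2 * \<nu>) v) $ a = (\<Sum>s<2 * \<nu>. g $$ (a, s) * v s)" if "a < 2 * \<nu>" for a
    using that g by (simp add: scalar_prod_def lessThan_atLeast0)
  have "quad \<nu> (g *\<^sub>v vec (2 * \<nu>) v) = quad_form \<nu> (\<lambda>a. \<Sum>s<2 * \<nu>. g $$ (a, s) * v s)"
    unfolding quad_def quad_form_def by (rule sum.cong) (simp_all add: entry)
  moreover have "quad \<nu> (vec (2 * \<nu>) v) = quad_form \<nu> v"
    unfolding quad_def quad_form_def by (rule sum.cong) simp_all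
  ultimately show ?thesis using q by simp
qed

text \<open>Substituting \<open>g v\<^sub>i\<close> for \<open>v\<^sub>i\<close> fixes every \<open>q(v\<^sub>i)\<close> and \<open>B\<^sub>i\<^sub>j\<close>.\<close>

lemma diag_act_dichotomy:
  fixes g :: "'k::field mat"
  assumes char2: "CHAR('k) = 2" and g: "g \<in> O_group \<nu>"
  shows "diag_act \<nu> g (Delta \<nu>) = Delta \<nu> \<or> diag_act \<nu> g (Delta \<nu>) = Delta \<nu> + reduce (D_poly \<nu>)"
proof (rule endomorphism_dichotomy[OF char2])
  let ?h = "diag_act \<nu> g"
  show hom: "comm_ring_hom ?h"
    unfolding diag_act_def[abs_def] by (rule comm_ring_hom.comm_ring_hom_eval_with[OF
        comm_ring_hom_Const])
  interpret comm_ring_hom ?h by (rule hom)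
  interpret R: comm_ring_hom "reduce :: _ \<Rightarrow> (nat \<times> nat, 'k) mpoly" by (rule comm_ring_hom_reduce)
  have var: "?h (Var (a, i)) = (\<Sum>s<2 * \<nu>. Const (g $$ (a, s)) * Var (s, i))" for a i
    by (simp add: diag_act_def eval_with_Var[OF comm_ring_hom_Const])
  have iso: "quad_form \<nu> (\<lambda>a. \<Sum>s<2 * \<nu>. Const (g $$ (a, s)) * w s) = quad_form \<nu> w" for w :: "nat
      \<Rightarrow> (nat \<times> nat, 'k) mpoly"
    by (rule quad_form_extend_scalars[OF comm_ring_hom_Const O_group_quad_form[OF g]])
  have Qv: "reduce (Q_poly \<nu> i) = quad_form \<nu> (\<lambda>a. Var (a, i) :: (nat \<times> nat, 'k) mpoly)" for i
    by (simp add: Q_poly_def quad_form_def R.hom_sum R.hom_mult reduce_Var)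
  have Bv: "reduce (B_poly \<nu> i j) = polar_form \<nu> (\<lambda>a. Var (a, i) :: (nat \<times> nat, 'k) mpoly) (\<lambda>a.
      Var (a, j))" for i j
    by (simp add: B_poly_def polar_form_def R.hom_sum R.hom_mult R.hom_add reduce_Var)
  have hq: "?h (quad_form \<nu> v) = quad_form \<nu> (\<lambda>a. ?h (v a))" for v
    by (simp add: quad_form_def hom_sum hom_mult)
  have hb: "?h (polar_form \<nu> v w) = polar_form \<nu> (\<lambda>a. ?h (v a)) (\<lambda>a. ?h (w a))" for v w
    by (simp add: polar_form_def hom_sum hom_mult hom_add)
  show "?h (reduce (Q_poly \<nu> i)) = reduce (Q_poly \<nu> i)" for i
    by (simp only: Qv hq var iso)
  have "polar_form \<nu> (\<lambda>a. \<Sum>s<2 * \<nu>. Const (g $$ (a, s)) * v s) (\<lambda>a. \<Sum>s<2 * \<nu>. Const (g $$ (a, s))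
      * w s) = polar_form \<nu> v w"
    for v w :: "nat \<Rightarrow> (nat \<times> nat, 'k) mpoly"
    unfolding polar_form_eq_quad_form iso by (simp only: sum.distrib[symmetric]
        distrib_left[symmetric] iso)
  then show "?h (reduce (B_poly \<nu> i j)) = reduce (B_poly \<nu> i j)" for i j
    by (simp only: Bv hb var)
qed

section \<open>Values of Delta at matrices\<close>

definition eval_mat :: "'k::field mat \<Rightarrow> (nat \<times> nat, 'k) mpoly \<Rightarrow> 'k" where
  "eval_mat A p = eval_with id (\<lambda>ij. A $$ ij) p"

lemma comm_ring_hom_eval_mat: "comm_ring_hom (eval_mat A)"
  unfolding eval_mat_def[abs_def] by (rule comm_ring_hom.comm_ring_hom_eval_with[OF
      comm_ring_hom_id])

lemma eval_mat_reduce: "eval_mat A (reduce p) = eval_with of_int (\<lambda>ij. A $$ ij) p"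
proof -
  have "eval_mat A (reduce p) = eval_with (eval_mat A \<circ> (Const \<circ> of_int)) (eval_mat A \<circ> Var) p"
    unfolding reduce_eq by (rule hom_eval_with[OF comm_ring_hom_eval_mat])
  also have "eval_mat A \<circ> (Const \<circ> of_int) = of_int"
    by (simp add: fun_eq_iff eval_mat_def eval_with_Const[OF comm_ring_hom_id])
  also have "eval_mat A \<circ> Var = (\<lambda>ij. A $$ ij)"
    by (simp add: fun_eq_iff eval_mat_def eval_with_Var[OF comm_ring_hom_id])
  finally show ?thesis .
qed

lemma eval_mat_D:
  assumes "A \<in> carrier_mat (2 * \<nu>) (2 * \<nu>)"
  shows "eval_mat A (reduce (D_poly \<nu>)) = det A"
proof -
  have hom: "comm_ring_hom (eval_with of_int (\<lambda>ij. A $$ ij))"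
    by (rule comm_ring_hom.comm_ring_hom_eval_with[OF of_int_hom.comm_ring_hom_axioms])
  interpret comm_ring_hom "eval_with of_int (\<lambda>ij. A $$ ij)" by (rule hom)
  have "map_mat (eval_with of_int (\<lambda>ij. A $$ ij)) (mat (2 * \<nu>) (2 * \<nu>) Var) = A"
    by (rule eq_matI) (use assms in \<open>auto simp: eval_with_Var[OF of_int_hom.comm_ring_hom_axioms]\<close>)
  then show ?thesis
    unfolding eval_mat_reduce D_poly_def using hom_det[of "mat (2 * \<nu>) (2 * \<nu>) Var"] by (simp only:)
qed

text \<open>The value at the identity matrix is the value at the standard basis, which \<open>g\<close> maps to
  its own columns.\<close>

lemma eval_mat_diag_act:
  fixes g :: "'k::field mat"
  assumes "g \<in> carrier_mat (2 * \<nu>) (2 * \<nu>)" and f: "f \<in> R_alg \<nu>"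
  shows "eval_mat (1\<^sub>m (2 * \<nu>)) (diag_act \<nu> g f) = eval_mat g f"
proof -
  let ?I = "1\<^sub>m (2 * \<nu>) :: 'k mat"
  interpret comm_ring_hom "eval_mat ?I" by (rule comm_ring_hom_eval_mat)
  have C: "eval_mat ?I (Const c) = c" for c
    by (simp add: eval_mat_def eval_with_Const[OF comm_ring_hom_id])
  have V: "eval_mat ?I (Var x) = ?I $$ x" for x
    by (simp add: eval_mat_def eval_with_Var[OF comm_ring_hom_id])
  have "eval_mat ?I (diag_act \<nu> g f) = eval_with (eval_mat ?I \<circ> Const)
      (eval_mat ?I \<circ> (\<lambda>(s, i). \<Sum>t<2 * \<nu>. Const (g $$ (s, t)) * Var (t, i))) f"
    unfolding diag_act_def by (rule hom_eval_with[OF comm_ring_hom_eval_mat])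
  also have "eval_mat ?I \<circ> Const = id" by (simp add: fun_eq_iff C)
  also have "eval_with id (eval_mat ?I \<circ> (\<lambda>(s, i). \<Sum>t<2 * \<nu>. Const (g $$ (s, t)) * Var (t, i))) f
      = eval_mat g f"
    unfolding eval_mat_def[of g]
  proof (rule eval_with_cong[OF f[unfolded R_alg_def]])
    fix x assume "x \<in> {0..<2 * \<nu>} \<times> {0..<2 * \<nu>}"
    then obtain s i where x: "x = (s, i)" and i: "i < 2 * \<nu>" by auto
    have "(\<Sum>t<2 * \<nu>. g $$ (s, t) * ?I $$ (t, i)) = (\<Sum>t<2 * \<nu>. if t = i then g $$ (s, t) else 0)"
      by (rule sum.cong) (use i in simp_all)
    then show "(eval_mat ?I \<circ> (\<lambda>(s, i). \<Sum>t<2 * \<nu>. Const (g $$ (s, t)) * Var (t, i))) x = g $$ x"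
      using i by (simp add: x hom_sum hom_mult C V)
  qed
  finally show ?thesis .
qed

text \<open>The value is computed over the integers, where the definition \<open>2\<Delta> = S - D\<close> can be
  used; the hypothesis on the Gram matrix implies \<open>S = 1\<close>.\<close>

lemma eval_Delta_integral:
  fixes U :: "nat \<Rightarrow> nat \<Rightarrow> int" and A :: "'k::field mat"
  assumes A: "\<And>i j. i < 2 * \<nu> \<Longrightarrow> j < 2 * \<nu> \<Longrightarrow> A $$ (i, j) = of_int (U i j)"
    and iso: "\<And>i j. i < 2 * \<nu> \<Longrightarrow> j < 2 * \<nu> \<Longrightarrow> base_change (2 * \<nu>) U (hyperbolic \<nu>) i j = hyperbolic
        \<nu> i j"
    and det: "det (mat_of (2 * \<nu>) U) = 1 - 2 * d"
  shows "eval_mat A (Delta \<nu>) = of_int d"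
proof -
  let ?e = "eval_with id (\<lambda>(i, j). U i j)"
  have hom: "comm_ring_hom ?e" by (rule comm_ring_hom.comm_ring_hom_eval_with[OF comm_ring_hom_id])
  interpret comm_ring_hom ?e by (rule hom)
  have "map_mat ?e (mat (2 * \<nu>) (2 * \<nu>) Var) = mat_of (2 * \<nu>) U"
    by (rule eq_matI) (auto simp: eval_with_Var[OF comm_ring_hom_id])
  then have D: "?e (D_poly \<nu>) = 1 - 2 * d"
    unfolding D_poly_def using hom_det[of "mat (2 * \<nu>) (2 * \<nu>) Var"] det by (simp only:)
  have "?e (B_poly \<nu> i j) = base_change (2 * \<nu>) U (hyperbolic \<nu>) i j" for i j
    by (simp add: B_poly_def base_change_hyperbolic hom_sum hom_add hom_mult eval_with_Var[OF
        comm_ring_hom_id])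
  then have "?e (S_poly \<nu>) = hafnian (base_change (2 * \<nu>) U (hyperbolic \<nu>)) {0..<2 * \<nu>}"
    by (simp only: S_poly_eq_hafnian hom_hafnian[OF hom])
  also have "\<dots> = hafnian (hyperbolic \<nu>) {0..<2 * \<nu>}" by (rule hafnian_cong) (simp add: iso)
  finally have S: "?e (S_poly \<nu>) = 1" by (simp add: hafnian_hyperbolic)
  have "?e (2 * Delta_int \<nu>) = 2 * d" by (simp add: Delta_int_eq hom_minus S D)
  then have "?e (Delta_int \<nu>) = d" by (simp add: hom_mult hom_numeral)
  then have "of_int d = (of_int (?e (Delta_int \<nu>)) :: 'k)" by (simp only:)
  also have "\<dots> = eval_with (of_int \<circ> id) (of_int \<circ> (\<lambda>(i, j). U i j)) (Delta_int \<nu>)"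
    by (rule hom_eval_with[OF of_int_hom.comm_ring_hom_axioms])
  also have "\<dots> = eval_with of_int (\<lambda>ij. A $$ ij) (Delta_int \<nu>)"
    unfolding comp_id by (rule eval_with_cong[OF Delta_int_in]) (clarsimp simp: A)
  finally show ?thesis by (simp add: Delta_eq_reduce eval_mat_reduce)
qed

lemma one_mat_in_O_group: "(1\<^sub>m (2 * \<nu>) :: 'k::field mat) \<in> O_group \<nu>"
  by (auto simp: O_group_def invertible_mat_def inverts_mat_def intro!: exI[of _ "1\<^sub>m (2 * \<nu>)"])

lemma eval_Delta_one: "eval_mat (1\<^sub>m (2 * \<nu>)) (Delta \<nu> :: (nat \<times> nat, 'k::field) mpoly) = 0"
proof -
  let ?U = "\<lambda>i j. if i = j then 1 else 0 :: int"
  have "eval_mat (1\<^sub>m (2 * \<nu>)) (Delta \<nu> :: (nat \<times> nat, 'k) mpoly) = of_int 0"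
  proof (rule eval_Delta_integral[where U = ?U])
    show "base_change (2 * \<nu>) ?U (hyperbolic \<nu>) i j = hyperbolic \<nu> i j" if "i < 2 * \<nu>" "j < 2 * \<nu>"
        for i j
      using that by (intro base_change_unit_cols) simp_all
    have "mat_of (2 * \<nu>) ?U = 1\<^sub>m (2 * \<nu>)" by (rule eq_matI) simp_all
    then show "det (mat_of (2 * \<nu>) ?U) = 1 - 2 * 0" by simp
  qed simp
  then show ?thesis by simp
qed

text \<open>Here \<open>D = -1\<close>, so \<open>\<Delta> = (1 - (-1)) / 2 = 1\<close>.\<close>

lemma eval_Delta_swap:
  assumes "\<nu> \<ge> 1"
  shows "eval_mat (swaprows_mat (2 * \<nu>) 0 \<nu>) (Delta \<nu> :: (nat \<times> nat, 'k::field) mpoly) = 1"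
proof -
  define f where "f = Transposition.transpose 0 \<nu>"
  define U where "U i j = (if i = f j then 1 else 0 :: int)" for i j
  have f_lt: "f i < 2 * \<nu>" if "i < 2 * \<nu>" for i
    using that assms by (auto simp: f_def Transposition.transpose_def)
  have "eval_mat (swaprows_mat (2 * \<nu>) 0 \<nu>) (Delta \<nu> :: (nat \<times> nat, 'k) mpoly) = of_int 1"
  proof (rule eval_Delta_integral[where U = U])
    show "swaprows_mat (2 * \<nu>) 0 \<nu> $$ (i, j) = (of_int (U i j) :: 'k)" if "i < 2 * \<nu>" "j < 2 * \<nu>"
        for i j
      using that by (auto simp: U_def f_def Transposition.transpose_def)
    show "base_change (2 * \<nu>) U (hyperbolic \<nu>) i j = hyperbolic \<nu> i j" if "i < 2 * \<nu>" "j < 2 * \<nu>"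
        for i j
    proof -
      have "base_change (2 * \<nu>) U (hyperbolic \<nu>) i j = hyperbolic \<nu> (f i) (f j)"
        by (rule base_change_unit_cols) (use that f_lt in \<open>simp_all add: U_def\<close>)
      also have "\<dots> = hyperbolic \<nu> i j"
        using that assms
        by (cases "i = 0"; cases "i = \<nu>"; cases "j = 0"; cases "j = \<nu>")
          (simp_all add: hyperbolic_def f_def Transposition.transpose_def)
      finally show ?thesis .
    qed
    have "mat_of (2 * \<nu>) U = swaprows_mat (2 * \<nu>) 0 \<nu>"
      by (rule eq_matI) (auto simp: U_def f_def Transposition.transpose_def)
    then show "det (mat_of (2 * \<nu>) U) = 1 - 2 * 1"
      using det_swaprows_mat[of 0 "2 * \<nu>" \<nu>, where 'a = int] assms by simp
  qed
  then show ?thesis by simp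
qed

lemma swap_in_O_group:
  assumes "\<nu> \<ge> 1"
  shows "(swaprows_mat (2 * \<nu>) 0 \<nu> :: 'k::field mat) \<in> O_group \<nu>"
proof -
  let ?g = "swaprows_mat (2 * \<nu>) 0 \<nu> :: 'k mat"
  have inv: "?g * ?g = 1\<^sub>m (2 * \<nu>)" by (rule swaprows_mat_inv) (use assms in auto)
  have "quad \<nu> (?g *\<^sub>v v) = quad \<nu> v" if v: "v \<in> carrier_vec (2 * \<nu>)" for v
  proof -
    have entry: "(?g *\<^sub>v v) $ i = v $ (Transposition.transpose 0 \<nu> i)" if i: "i < 2 * \<nu>" for i
    proof -
      let ?f = "Transposition.transpose 0 \<nu>"
      have fi: "?f i < 2 * \<nu>" using i assms by (auto simp: Transposition.transpose_def)
      have "(?g *\<^sub>v v) $ i = (\<Sum>j = 0..<2 * \<nu>. ?g $$ (i, j) * v $ j)"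
        using i v by (simp add: scalar_prod_def)
      also have "\<dots> = (\<Sum>j = 0..<2 * \<nu>. if j = ?f i then v $ j else 0)"
        by (rule sum.cong) (use i in \<open>auto simp: Transposition.transpose_def\<close>)
      also have "\<dots> = v $ (?f i)" using fi by simp
      finally show ?thesis .
    qed
    show ?thesis
      unfolding quad_def
    proof (rule sum.cong)
      fix t assume "t \<in> {..<\<nu>}"
      then show "(?g *\<^sub>v v) $ t * (?g *\<^sub>v v) $ (\<nu> + t) = v $ t * v $ (\<nu> + t)"
        using entry[of t] entry[of "\<nu> + t"] by (cases "t = 0") (simp_all add:
            Transposition.transpose_def mult.commute)
    qed simp
  qed
  then show ?thesis
    using inv by (auto simp: O_group_def invertible_mat_def inverts_mat_def intro!: exI[of _ ?g])
qed

section \<open>The identity component and the theorem\<close>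

lemma openin_zariski_principal:
  assumes "p \<in> polys_in ({0..<n} \<times> {0..<n})"
  shows "openin (zariski_mat n) {A \<in> carrier_mat n n. eval_mat A p \<noteq> 0}"
  unfolding zariski_mat_def eval_mat_def
  by (rule topology_generated_by_Basis) (use assms in blast)

text \<open>On the orthogonal group \<open>\<Delta>(g)\<close> takes the values 0 and 1 only, according to the two
  cases of the dichotomy, because \<open>D\<close> has value 1 at the identity matrix. The principal open
  sets of \<open>\<Delta> - 1\<close> and of \<open>\<Delta>\<close> therefore cut the group into two disjoint open pieces, and a
  connected set containing the identity stays in the first.\<close>

lemma SO_group_invariant:
  assumes char2: "CHAR('k::field) = 2" and g: "(g :: 'k mat) \<in> SO_group \<nu>"
  shows "diag_act \<nu> g (Delta \<nu>) = Delta \<nu>"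
proof -
  let ?n = "2 * \<nu>" and ?\<Delta> = "Delta \<nu> :: (nat \<times> nat, 'k) mpoly"
  let ?E1 = "{A \<in> carrier_mat ?n ?n. eval_mat A (?\<Delta> - 1) \<noteq> 0}"
  let ?E2 = "{A \<in> carrier_mat ?n ?n. eval_mat A ?\<Delta> \<noteq> 0}"
  have carrier: "A \<in> carrier_mat ?n ?n" if "A \<in> O_group \<nu>" for A :: "'k mat"
    using that by (simp add: O_group_def)
  have D1: "eval_mat (1\<^sub>m ?n) (reduce (D_poly \<nu>)) = (1 :: 'k)" by (simp add: eval_mat_D)
  have act: "eval_mat A ?\<Delta> = eval_mat (1\<^sub>m ?n) (diag_act \<nu> A ?\<Delta>)" if "A \<in> O_group \<nu>" for A
    by (rule eval_mat_diag_act[OF carrier[OF that] Delta_in_R_alg, symmetric])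
  have add: "eval_mat A (p + q) = eval_mat A p + eval_mat A q" and
    sub1: "eval_mat A (p - 1) = eval_mat A p - 1" for A :: "'k mat" and p q
  proof -
    interpret comm_ring_hom "eval_mat A" by (rule comm_ring_hom_eval_mat)
    show "eval_mat A (p + q) = eval_mat A p + eval_mat A q" "eval_mat A (p - 1) = eval_mat A p - 1"
      by (simp_all only: hom_add hom_minus hom_one)
  qed
  have moved: "eval_mat A ?\<Delta> = 1" if "A \<in> O_group \<nu>" "diag_act \<nu> A ?\<Delta> \<noteq> ?\<Delta>" for A
    using diag_act_dichotomy[OF char2 that(1)] that(2)
    by (simp add: act[OF that(1)] add D1 eval_Delta_one)
  have fixed: "eval_mat A ?\<Delta> = 0" if "A \<in> O_group \<nu>" "diag_act \<nu> A ?\<Delta> = ?\<Delta>" for A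
    by (simp add: act[OF that(1)] that(2) eval_Delta_one)
  have \<Delta>_in: "?\<Delta> \<in> polys_in ({0..<?n} \<times> {0..<?n})" using Delta_in_R_alg by (simp add: R_alg_def)
  obtain C where C: "connectedin (subtopology (zariski_mat ?n) (O_group \<nu>)) C" "1\<^sub>m ?n \<in> C" "g \<in> C"
    using g by (auto simp: SO_group_def connected_component_of_def)
  then have conn: "connectedin (zariski_mat ?n) C" and sub: "C \<subseteq> O_group \<nu>"
    by (auto simp: connectedin_subtopology)
  have "g \<notin> ?E2"
  proof
    assume "g \<in> ?E2"
    show False
    proof (rule connectedinD[OF conn])
      show "openin (zariski_mat ?n) ?E1"
        by (intro openin_zariski_principal polys_in_diff \<Delta>_in polys_in_1)
      show "openin (zariski_mat ?n) ?E2" by (rule openin_zariski_principal[OF \<Delta>_in])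
      show "C \<subseteq> ?E1 \<union> ?E2"
        using sub carrier by (auto simp: sub1)
      show "?E1 \<inter> ?E2 \<inter> C = {}"
        using sub moved fixed by (auto simp: sub1)
      show "?E1 \<inter> C \<noteq> {}"
      proof -
        have "1\<^sub>m ?n \<in> ?E1" by (simp add: sub1 eval_Delta_one)
        then show ?thesis using C(2) by blast
      qed
      show "?E2 \<inter> C \<noteq> {}" using C(3) \<open>g \<in> ?E2\<close> by blast
    qed
  qed
  moreover have "g \<in> O_group \<nu>" using C(3) sub by blast
  ultimately show ?thesis using moved carrier by fastforce
qed

theorem theorem3p4:
  fixes \<nu> :: nat
  assumes "CHAR('k::alg_closed_field) = 2"
    and "\<nu> \<ge> 1"
  shows "(Delta \<nu> :: (nat \<times> nat, 'k) mpoly) \<in> R_alg \<nu>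
    \<and> invariant_under \<nu> (SO_group \<nu>) (Delta \<nu> :: (nat \<times> nat, 'k) mpoly)
    \<and> \<not> invariant_under \<nu> (O_group \<nu>) (Delta \<nu> :: (nat \<times> nat, 'k) mpoly)"
proof (intro conjI)
  let ?\<Delta> = "Delta \<nu> :: (nat \<times> nat, 'k) mpoly"
  let ?g = "swaprows_mat (2 * \<nu>) 0 \<nu> :: 'k mat"
  show "?\<Delta> \<in> R_alg \<nu>" by (rule Delta_in_R_alg)
  show "invariant_under \<nu> (SO_group \<nu>) ?\<Delta>"
    unfolding invariant_under_def using SO_group_invariant[OF assms(1)] by blast
  have "eval_mat (1\<^sub>m (2 * \<nu>)) (diag_act \<nu> ?g ?\<Delta>) = 1"
    using eval_mat_diag_act[OF _ Delta_in_R_alg, of ?g \<nu>] eval_Delta_swap[OF assms(2), where 'k =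
        'k] by simp
  then have "diag_act \<nu> ?g ?\<Delta> \<noteq> ?\<Delta>" using eval_Delta_one[of \<nu>, where 'k = 'k] by auto
  then show "\<not> invariant_under \<nu> (O_group \<nu>) ?\<Delta>"
    unfolding invariant_under_def using swap_in_O_group[OF assms(2)] by blast
qed

end
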